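(* For online sorting of $n$ items, the best competitive ratio achievable by deterministic online algorithms and the best competitive ratio achievable by randomized online algorithms (against an oblivious adversary) are both $\Theta(\sqrt{n})$. That is, there is a deterministic online algorithm with competitive ratio $O(\sqrt{n})$ on arbitrary sequences of $n$ reals, and every (possibly randomized) online algorithm has competitive ratio $\Omega(\sqrt{n})$. The lower bound $\Omega(\sqrt{n})$ holds even when all input numbers are restricted to lie in $[0,1]$.
   Context: Online sorting: a sequence $X=(x_1,\dots,x_n)$ of reals is revealed one item at a time. An online algorithm maintains an array $A[1],\dots,A[n]$ of initially empty cells; upon receiving $x_j$ (for $j=1,\dots,n$) it must immediately and irrevocably write $x_j$ into some previously empty cell. The cost of the final array is $\sum_{i=1}^{n-1}|A[i+1]-A[i]|$. $\mathtt{OPT}(X)$ denotes the minimum of this cost over all bijective placements of $x_1,\dots,x_n$ into the cells (the offline optimum). The competitive ratio of a deterministic algorithm $\mathcal A$ is the supremum over all inputs $X$ of size $n$ of $\mathcal A(X)/\mathtt{OPT}(X)$, where $\mathcal A(X)$ is its cost on $X$; for a randomized algorithm it is the supremum of $\mathbb E[\mathcal A(X)]/\mathtt{OPT}(X)$, the expectation being over the algorithm's random choices, with the input fixed in advance without knowledge of these random choices (oblivious adversary). *)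

theory Defs
  imports
    "HOL-Probability.Probability"
    "HOL-Combinatorics.Permutations"
    "HOL-Library.Landau_Symbols"
begin

text \<open>
  Cells and item indices both range over \<open>{..<n}\<close>, so the cells \<open>A[1], \<dots>, A[n]\<close> are numbered
  from \<open>0\<close>. A parameter \<open>S\<close> is the set of reals from which the items may be drawn.
\<close>

definition inputs :: "real set \<Rightarrow> nat \<Rightarrow> real list set" where
  "inputs S n = {xs. length xs = n \<and> set xs \<subseteq> S}"

definition array_cost :: "nat \<Rightarrow> (nat \<Rightarrow> real) \<Rightarrow> real" where
  "array_cost n B = (\<Sum>i<n - 1. \<bar>B (Suc i) - B i\<bar>)"

text \<open>The array resulting from writing the item \<open>xs ! j\<close> into the cell \<open>p j\<close>.\<close>

definition fill :: "real list \<Rightarrow> (nat \<Rightarrow> nat) \<Rightarrow> nat \<Rightarrow> real" where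
  "fill xs p = (\<lambda>i. xs ! the_inv_into {..<length xs} p i)"

definition OPT :: "real list \<Rightarrow> real" where
  "OPT xs = Min ((\<lambda>p. array_cost (length xs) (fill xs p)) ` {p. p permutes {..<length xs}})"

text \<open>
  A deterministic algorithm maps the list of items revealed so far, whose last element is the
  current item, to the cell receiving the current item. Earlier placements need not be passed to
  it, as they are determined by the earlier items.
\<close>

type_synonym det_alg = "real list \<Rightarrow> nat"

definition placement :: "det_alg \<Rightarrow> real list \<Rightarrow> nat \<Rightarrow> nat" where
  "placement A xs j = A (take (Suc j) xs)"

definition online_alg :: "real set \<Rightarrow> nat \<Rightarrow> det_alg \<Rightarrow> bool" where
  "online_alg S n A \<longleftrightarrow>
     (\<forall>xs\<in>inputs S n. \<forall>j<n. placement A xs j \<in> {..<n} - placement A xs ` {..<j})"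

definition alg_cost :: "det_alg \<Rightarrow> real list \<Rightarrow> real" where
  "alg_cost A xs = array_cost (length xs) (fill xs (placement A xs))"

text \<open>
  A randomized algorithm is a probability distribution over deterministic algorithms. The
  measurability condition says that every single decision is a random variable. Since the measure
  is fixed before the input is chosen, the adversary is oblivious.
\<close>

definition randomized_online_alg :: "real set \<Rightarrow> nat \<Rightarrow> det_alg measure \<Rightarrow> bool" where
  "randomized_online_alg S n M \<longleftrightarrow>
     prob_space M \<and> space M \<subseteq> {A. online_alg S n A} \<and>
     (\<forall>xs. length xs \<le> n \<and> set xs \<subseteq> S \<longrightarrow> (\<lambda>A. A xs) \<in> M \<rightarrow>\<^sub>M count_space UNIV)"

text \<open>
  If \<open>OPT xs = 0\<close>, then all items are equal and every algorithm has cost \<open>0\<close>; by \<open>0 / 0 = 0\<close> on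
  \<^typ>\<open>ennreal\<close> such inputs do not contribute to the suprema below.
\<close>

definition det_ratio :: "real set \<Rightarrow> nat \<Rightarrow> det_alg \<Rightarrow> ennreal" where
  "det_ratio S n A = (SUP xs\<in>inputs S n. ennreal (alg_cost A xs) / ennreal (OPT xs))"

definition rand_ratio :: "real set \<Rightarrow> nat \<Rightarrow> det_alg measure \<Rightarrow> ennreal" where
  "rand_ratio S n M =
     (SUP xs\<in>inputs S n. (\<integral>\<^sup>+A. ennreal (alg_cost A xs) \<partial>M) / ennreal (OPT xs))"

definition best_det_ratio :: "real set \<Rightarrow> nat \<Rightarrow> ennreal" where
  "best_det_ratio S n = (INF A\<in>{A. online_alg S n A}. det_ratio S n A)"

definition best_rand_ratio :: "real set \<Rightarrow> nat \<Rightarrow> ennreal" where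
  "best_rand_ratio S n = (INF M\<in>{M. randomized_online_alg S n M}. rand_ratio S n M)"

end

theory Submission
  imports Defs
begin

text \<open>
  Upper bound. Cut the \<open>n\<close> cells into blocks of about \<open>\<surd>n\<close> cells, each filled from left to right, and
  round the items to about \<open>\<surd>n / 4\<close> buckets covering an interval of radius \<open>W\<close> around the first item.
  Each bucket writes into a block of its own; when that block is full, the bucket takes over an
  unlabelled block, a partially filled one if possible. When an item falls outside the interval, \<open>W\<close> at least
  doubles and all labels are erased. Two items of one bucket differ by \<open>O(W / \<surd>n)\<close>, and between two changes
  of \<open>W\<close> only \<open>O(\<surd>n)\<close> partially filled blocks change their bucket, at a cost of \<open>O(W)\<close> each; since the
  radii grow geometrically, all this sums up to \<open>O(\<surd>n OPT)\<close>. Once every block with an empty cell has a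
  label, at most \<open>n / 2\<close> cells are empty, and one recurses on those as if they were contiguous.

  Lower bound. Draw items independently and uniformly from \<open>m\<close> equidistant points of \<open>[1/2, 1]\<close>, where
  \<open>m\<close> is about \<open>\<surd>n\<close>, and let \<open>b\<close> be the number of adjacent pairs consisting of an occupied and an empty
  cell. An item that differs from all values next to empty cells either incurs a cost of at least
  \<open>1 / (2 m)\<close> at each of its neighbours or increases \<open>b\<close>. Hence \<open>b + 4 m cost\<close> grows by at least
  \<open>1 - 3 b / m\<close> per step in expectation. Switching to the input \<open>0, 0, \<dots>\<close> at any time costs at least
  \<open>b / 2\<close>. Summing over all steps, the costs of these \<open>n + 1\<close> random inputs, weighted by \<open>4 m\<close>
  respectively \<open>6 / m\<close>, add up to at least \<open>n\<close>.
\<close>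

section \<open>Array costs and the offline optimum\<close>

lemma online_alg_bij_betw:
  assumes "online_alg S n A" "xs \<in> inputs S n"
  shows "bij_betw (placement A xs) {..<n} {..<n}"
proof -
  have *: "placement A xs j \<in> {..<n} - placement A xs ` {..<j}" if "j < n" for j
    using assms that by (simp add: online_alg_def)
  have "inj_on (placement A xs) {..<n}"
  proof (rule linorder_inj_onI)
    fix i j assume "i < j" "i \<in> {..<n}" "j \<in> {..<n}"
    then have "placement A xs i \<in> placement A xs ` {..<j}" "j < n"
      by auto
    then show "placement A xs i \<noteq> placement A xs j"
      using *[of j] by (metis DiffD2)
  qed auto
  moreover have "placement A xs ` {..<n} \<subseteq> {..<n}"
    using * by blast
  ultimately show ?thesis
    by (simp add: bij_betw_def endo_inj_surj)
qed

lemma array_cost_nonneg: "0 \<le> array_cost n B"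
  by (simp add: array_cost_def sum_nonneg)

lemma alg_cost_nonneg: "0 \<le> alg_cost A xs"
  by (simp add: alg_cost_def array_cost_nonneg)

lemma array_cost_ge:
  assumes "i < n" "j < n"
  shows "\<bar>B i - B j\<bar> \<le> array_cost n B"
proof -
  have *: "\<bar>B j - B i\<bar> \<le> array_cost n B" if "i \<le> j" "j < n" for i j
  proof -
    have "\<bar>B j - B i\<bar> = \<bar>\<Sum>k = i..<j. B (Suc k) - B k\<bar>"
      using that by (simp add: sum_Suc_diff')
    also have "\<dots> \<le> (\<Sum>k = i..<j. \<bar>B (Suc k) - B k\<bar>)"
      by (rule sum_abs)
    also have "\<dots> \<le> array_cost n B"
      unfolding array_cost_def using that by (intro sum_mono2) auto
    finally show ?thesis .
  qed
  show ?thesis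
    using *[of i j] *[of j i] assms by (cases "i \<le> j") (auto simp: abs_minus_commute)
qed

lemma OPT_le:
  "p permutes {..<length xs} \<Longrightarrow> OPT xs \<le> array_cost (length xs) (fill xs p)"
  unfolding OPT_def by (intro Min_le) (auto simp: finite_permutations)

text \<open>Whatever the placement, the steps between the cells of \<open>u\<close> and
  \<open>v\<close> add up to at least their difference. The upper bound thus compares the algorithm
  with the spread of the items instead of the optimum.\<close>

lemma abs_diff_le_OPT:
  assumes "u \<in> set xs" "v \<in> set xs"
  shows "\<bar>u - v\<bar> \<le> OPT xs"
proof -
  obtain i j where i: "i < length xs" "u = xs ! i" and j: "j < length xs" "v = xs ! j"
    using assms by (auto simp: in_set_conv_nth)
  have "\<bar>u - v\<bar> \<le> array_cost (length xs) (fill xs p)" if p: "p permutes {..<length xs}" for p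
  proof -
    have "fill xs p (p i) = u" "fill xs p (p j) = v"
      using i j p by (simp_all add: fill_def the_inv_into_f_f permutes_inj_on)
    moreover have "p i < length xs" "p j < length xs"
      using permutes_in_image[OF p] i j by auto
    ultimately show ?thesis
      using array_cost_ge by metis
  qed
  moreover have "{p. p permutes {..<length xs}} \<noteq> {}"
    using permutes_id by blast
  ultimately show ?thesis
    unfolding OPT_def by (subst Min_ge_iff) (auto simp: finite_permutations)
qed

lemma array_cost_sorted:
  assumes "\<And>i j. i \<le> j \<Longrightarrow> j < n \<Longrightarrow> B i \<le> B j" "0 < n"
  shows "array_cost n B = B (n - 1) - B 0"
proof -
  have "array_cost n B = (\<Sum>i<n - 1. B (Suc i) - B i)"
    unfolding array_cost_def
  proof (rule sum.cong)
    fix i assume "i \<in> {..<n - 1}"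
    then show "\<bar>B (Suc i) - B i\<bar> = B (Suc i) - B i"
      using assms(1)[of i "Suc i"] by simp
  qed simp
  then show ?thesis
    by (simp add: sum_lessThan_telescope)
qed

lemma OPT_le_1:
  assumes "xs \<in> inputs {0..1} n"
  shows "OPT xs \<le> 1"
proof -
  have len: "length xs = n" and xs: "set xs \<subseteq> {0..1}"
    using assms by (auto simp: inputs_def)
  obtain p where p: "p permutes {..<length xs}" "permute_list p xs = sort xs"
    using mset_eq_permutation[of "sort xs" xs] by auto
  \<comment> \<open>\<open>p\<close> sends a cell to the item that belongs there in sorted order,
    whereas placements send items to cells.\<close>
  let ?q = "inv p"
  have q: "?q permutes {..<length xs}"
    using p(1) by (rule permutes_inv)
  have fill: "fill xs ?q i = sort xs ! i" if "i < length xs" for i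
  proof -
    have pi: "p i < length xs"
      using permutes_in_image[OF p(1)] that by simp
    have "the_inv_into {..<length xs} ?q (?q (p i)) = p i"
      using pi q by (simp add: the_inv_into_f_f permutes_inj_on)
    then have "the_inv_into {..<length xs} ?q i = p i"
      using permutes_inverses[OF p(1)] by simp
    then show ?thesis
      using that p by (simp add: fill_def permute_list_nth flip: p(2))
  qed
  have "array_cost (length xs) (fill xs ?q) \<le> 1"
  proof (cases "n = 0")
    case False
    have "array_cost (length xs) (fill xs ?q) = fill xs ?q (length xs - 1) - fill xs ?q 0"
      by (rule array_cost_sorted) (use False len fill in \<open>auto simp: sorted_nth_mono\<close>)
    moreover have "fill xs ?q i \<in> {0..1}" if "i < length xs" for i
    proof -
      have "sort xs ! i \<in> set (sort xs)"
        using that by (intro nth_mem) simp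
      then show ?thesis
        using xs fill[OF that] by auto
    qed
    from this[of 0] this[of "length xs - 1"] have "0 \<le> fill xs ?q 0" "fill xs ?q (length xs - 1) \<le> 1"
      using False len by auto
    ultimately show ?thesis
      by linarith
  qed (simp add: array_cost_def len)
  then show ?thesis
    using OPT_le[OF q] by linarith
qed

section \<open>Total variation of lists\<close>

fun tv :: "real list \<Rightarrow> real" where
  "tv [] = 0"
| "tv [x] = 0"
| "tv (x # y # zs) = \<bar>y - x\<bar> + tv (y # zs)"

lemma tv_append:
  "xs \<noteq> [] \<Longrightarrow> ys \<noteq> [] \<Longrightarrow> tv (xs @ ys) = tv xs + \<bar>hd ys - last xs\<bar> + tv ys"
  by (induction xs rule: tv.induct) (auto simp: neq_Nil_conv)

lemma tv_append_ge: "tv xs + tv ys \<le> tv (xs @ ys)"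
  by (cases "xs = [] \<or> ys = []") (auto simp: tv_append)

lemma tv_append_le:
  assumes "0 \<le> D" "\<And>u v. u \<in> set xs \<Longrightarrow> v \<in> set ys \<Longrightarrow> \<bar>v - u\<bar> \<le> D"
  shows "tv (xs @ ys) \<le> tv xs + tv ys + D"
proof (cases "xs = [] \<or> ys = []")
  case False
  then have "\<bar>hd ys - last xs\<bar> \<le> D"
    using assms(2) by simp
  then show ?thesis
    using False by (simp add: tv_append)
qed (use assms(1) in auto)

lemma tv_le_length:
  assumes "0 \<le> D" "\<And>u v. u \<in> set xs \<Longrightarrow> v \<in> set xs \<Longrightarrow> \<bar>v - u\<bar> \<le> D"
  shows "tv xs \<le> real (length xs) * D"
  using assms(2)
proof (induction xs)
  case (Cons x xs)
  have "tv ([x] @ xs) \<le> tv [x] + tv xs + D"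
    by (rule tv_append_le) (use assms(1) Cons.prems in auto)
  moreover have "tv xs \<le> real (length xs) * D"
    by (rule Cons.IH) (use Cons.prems in auto)
  ultimately show ?case
    by (simp add: algebra_simps)
qed simp

lemma tv_map_upt: "tv (map B [0..<n]) = array_cost n B"
proof (induction n)
  case (Suc n)
  show ?case
  proof (cases n)
    case (Suc m)
    then have "tv (map B [0..<n] @ [B n]) = tv (map B [0..<n]) + \<bar>B n - B m\<bar>"
      by (subst tv_append) auto
    then show ?thesis
      using Suc.IH Suc by (simp add: array_cost_def)
  qed (simp add: array_cost_def)
qed (simp add: array_cost_def)

text \<open>Each block has two junctions, one before and one after \<open>F b\<close>, of at most
  \<open>D\<close> each. The pieces \<open>R b\<close> are compared with their concatenation, whose
  variation is at least the sum of theirs. This lets scattered leftover cells be treated as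
  contiguous.\<close>

lemma tv_concat_le:
  assumes "0 \<le> D"
    and "\<And>u v. u \<in> set (concat (map (\<lambda>b. F b @ R b) [0..<N])) \<Longrightarrow>
           v \<in> set (concat (map (\<lambda>b. F b @ R b) [0..<N])) \<Longrightarrow> \<bar>v - u\<bar> \<le> D"
  shows "tv (concat (map (\<lambda>b. F b @ R b) [0..<N]))
    \<le> (\<Sum>b<N. tv (F b)) + tv (concat (map R [0..<N])) + 2 * real N * D"
  using assms(2)
proof (induction N)
  case (Suc N)
  let ?X = "concat (map (\<lambda>b. F b @ R b) [0..<N])" and ?Y = "concat (map R [0..<N])"
  have "tv ?X \<le> (\<Sum>b<N. tv (F b)) + tv ?Y + 2 * real N * D"
    by (rule Suc.IH) (rule Suc.prems; simp)
  moreover have "tv (?X @ (F N @ R N)) \<le> tv ?X + tv (F N @ R N) + D"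
    by (rule tv_append_le[OF assms(1)]) (rule Suc.prems; simp)
  moreover have "tv (F N @ R N) \<le> tv (F N) + tv (R N) + D"
    by (rule tv_append_le[OF assms(1)]) (rule Suc.prems; simp)
  moreover have "tv ?Y + tv (R N) \<le> tv (?Y @ R N)"
    by (rule tv_append_ge)
  ultimately show ?case
    by (simp add: algebra_simps)
qed simp

section \<open>Online filling as a game\<close>

text \<open>
  \<open>win r E P\<close>: any \<open>r\<close> items can be written online into the empty cells \<open>E\<close> so that every array \<open>B\<close> with
  these entries satisfies \<open>P\<close>. Entries outside \<open>E\<close> are left arbitrary in \<open>B\<close>; the predicate has to account for
  those written earlier.
\<close>

primrec win :: "nat \<Rightarrow> nat set \<Rightarrow> ((nat \<Rightarrow> real) \<Rightarrow> bool) \<Rightarrow> bool" where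
  "win 0 E P \<longleftrightarrow> (\<forall>B. P B)"
| "win (Suc r) E P \<longleftrightarrow> (\<forall>x. \<exists>c\<in>E. win r (E - {c}) (\<lambda>B. P (B(c := x))))"

lemma win_mono: "win r E P \<Longrightarrow> (\<And>B. P B \<Longrightarrow> Q B) \<Longrightarrow> win r E Q"
proof (induction r arbitrary: E P Q)
  case (Suc r)
  show ?case
    unfolding win.simps
  proof
    fix x
    obtain c where c: "c \<in> E" "win r (E - {c}) (\<lambda>B. P (B(c := x)))"
      using Suc.prems(1) by auto
    have "win r (E - {c}) (\<lambda>B. Q (B(c := x)))"
      by (rule Suc.IH[OF c(2)]) (rule Suc.prems(2))
    with c(1) show "\<exists>c\<in>E. win r (E - {c}) (\<lambda>B. Q (B(c := x)))"
      by blast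
  qed
qed simp

text \<open>The strategy may depend on a parameter \<open>a\<close> chosen after the first item is
  seen: that item ends up in \<open>E\<close>, so taking it for \<open>a\<close> fulfils the
  premise. It becomes the fixed centre of the buckets.\<close>

lemma win_first_item:
  assumes "\<And>a. win (Suc r) E (\<lambda>B. a \<in> B ` E \<longrightarrow> P B)"
  shows "win (Suc r) E P"
  unfolding win.simps
proof
  fix x
  obtain c where c: "c \<in> E" "win r (E - {c}) (\<lambda>B. x \<in> (B(c := x)) ` E \<longrightarrow> P (B(c := x)))"
    using assms[of x] unfolding win.simps by blast
  have "win r (E - {c}) (\<lambda>B. P (B(c := x)))"
    by (rule win_mono[OF c(2)]) (use c(1) in force)
  with c(1) show "\<exists>c\<in>E. win r (E - {c}) (\<lambda>B. P (B(c := x)))"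
    by blast
qed

lemma win_any:
  "finite E \<Longrightarrow> card E = r \<Longrightarrow> (\<And>B. P B) \<Longrightarrow> win r E P"
proof (induction r arbitrary: E P)
  case (Suc r)
  then obtain c where "c \<in> E"
    by fastforce
  with Suc show ?case
    by (auto intro!: bexI[of _ c])
qed simp

text \<open>For each first item \<open>x\<close> the game yields a cell \<open>c x\<close> and, by
  induction, an algorithm \<open>A x\<close> for the remaining items; the head of the list tells
  which of them to follow.\<close>

lemma win_imp_alg:
  assumes "win r E P"
  shows "\<exists>A. \<forall>xs. length xs = r \<longrightarrow>
    (\<forall>j<r. placement A xs j \<in> E - placement A xs ` {..<j}) \<and>
    (\<forall>B. (\<forall>j<r. B (placement A xs j) = xs ! j) \<longrightarrow> P B)"
  using assms
proof (induction r arbitrary: E P)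
  case (Suc r)
  define good where "good E r P A \<longleftrightarrow> (\<forall>xs. length xs = r \<longrightarrow>
    (\<forall>j<r. placement A xs j \<in> E - placement A xs ` {..<j}) \<and>
    (\<forall>B. (\<forall>j<r. B (placement A xs j) = xs ! j) \<longrightarrow> P B))" for E r P A
  have "\<forall>x. \<exists>c A. c \<in> E \<and> good (E - {c}) r (\<lambda>B. P (B(c := x))) A"
  proof
    fix x
    obtain c where c: "c \<in> E" "win r (E - {c}) (\<lambda>B. P (B(c := x)))"
      using Suc.prems unfolding win.simps by blast
    then show "\<exists>c A. c \<in> E \<and> good (E - {c}) r (\<lambda>B. P (B(c := x))) A"
      using Suc.IH[OF c(2)] unfolding good_def by blast
  qed
  then obtain c A where c: "\<And>x. c x \<in> E"
    and A: "\<And>x. good (E - {c x}) r (\<lambda>B. P (B(c x := x))) (A x)"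
    by metis
  define A' where "A' ys = (case ys of [] \<Rightarrow> 0 | x # zs \<Rightarrow> if zs = [] then c x else A x zs)" for ys
  have pl0: "placement A' (x # zs) 0 = c x" for x zs
    by (simp add: placement_def A'_def)
  have plS: "placement A' (x # zs) (Suc j) = placement (A x) zs j" if "j < length zs" for x zs j
    using that by (auto simp: placement_def A'_def)
  have "good E (Suc r) P A'"
    unfolding good_def
  proof (intro allI impI)
    fix xs :: "real list" assume "length xs = Suc r"
    then obtain x zs where xs: "xs = x # zs" "length zs = r"
      by (auto simp: length_Suc_conv)
    have zs: "placement (A x) zs j \<in> E - {c x} - placement (A x) zs ` {..<j}" if "j < r" for j
      using A[of x] xs(2) that unfolding good_def by blast
    have zsP: "P (B(c x := x))" if "\<forall>j<r. B (placement (A x) zs j) = zs ! j" for B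
      using A[of x] xs(2) that unfolding good_def by blast
    have "placement A' xs j \<in> E - placement A' xs ` {..<j}" if "j < Suc r" for j
    proof (cases j)
      case (Suc i)
      have "placement A' xs ` {..<j} = insert (c x) (placement (A x) zs ` {..<i})"
        using that Suc xs by (auto simp: lessThan_Suc_eq_insert_0 image_image pl0 plS)
      then show ?thesis
        using zs[of i] that Suc xs by (simp add: plS)
    qed (simp add: xs pl0 c)
    moreover have "P B" if B: "\<forall>j<Suc r. B (placement A' xs j) = xs ! j" for B
    proof -
      have "B (c x) = x"
        using B[rule_format, of 0] by (simp add: xs pl0)
      moreover have "\<forall>j<r. B (placement (A x) zs j) = zs ! j"
        using B[rule_format, of "Suc _"] xs by (auto simp: plS)
      ultimately show ?thesis
        using zsP[of B] by (metis fun_upd_triv)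
    qed
    ultimately show "(\<forall>j<Suc r. placement A' xs j \<in> E - placement A' xs ` {..<j}) \<and>
        (\<forall>B. (\<forall>j<Suc r. B (placement A' xs j) = xs ! j) \<longrightarrow> P B)"
      by blast
  qed
  then show ?case
    unfolding good_def by blast
qed simp

section \<open>One round of filling blocks\<close>

text \<open>\<open>D\<close> takes the place of the optimum, which is at least the spread of the
  values. Quantifying over all \<open>D\<close> lets a bound valid on the whole array be reused on a
  sublist of its cells.\<close>

definition fills_well :: "real \<Rightarrow> nat list \<Rightarrow> (nat \<Rightarrow> real) \<Rightarrow> bool" where
  "fills_well C es B \<longleftrightarrow>
     (\<forall>D\<ge>0. (\<forall>c\<in>set es. \<forall>c'\<in>set es. \<bar>B c - B c'\<bar> \<le> D) \<longrightarrow> tv (map B es) \<le> C * D)"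

text \<open>
  The state of a round: \<open>cnt b\<close> cells of block \<open>b\<close> have been filled, \<open>lab b\<close> is the bucket that owns block \<open>b\<close>,
  \<open>A\<close> holds the entries written so far, and all of them are within \<open>W\<close> of the first item \<open>a\<close>.
  For \<open>W = 0\<close> the division by zero puts all items into bucket \<open>0\<close>, as it should.
\<close>

locale blocks =
  fixes blk :: "nat \<Rightarrow> nat list" and N s k :: nat and a :: real
  assumes blk_distinct: "b < N \<Longrightarrow> distinct (blk b)"
    and blk_disjoint: "b < N \<Longrightarrow> b' < N \<Longrightarrow> b \<noteq> b' \<Longrightarrow> set (blk b) \<inter> set (blk b') = {}"
    and blk_length: "b < N \<Longrightarrow> length (blk b) \<le> s"
    and k_pos: "0 < k"
begin

definition cells :: "nat list" where
  "cells = concat (map blk [0..<N])"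

definition free_cells :: "(nat \<Rightarrow> nat) \<Rightarrow> nat list" where
  "free_cells cnt = concat (map (\<lambda>b. drop (cnt b) (blk b)) [0..<N])"

text \<open>The number of buckets \<open>- k, ..., k\<close>; for positive \<open>W\<close> the
  right end \<open>a + W\<close> has a bucket of its own, hence the \<open>1\<close>.\<close>

definition K :: nat where
  "K = 2 * k + 1"

definition bucket :: "real \<Rightarrow> real \<Rightarrow> int" where
  "bucket W v = \<lfloor>(v - a) * real k / W\<rfloor>"

definition opened :: "(nat \<Rightarrow> nat) \<Rightarrow> nat set" where
  "opened cnt = {b. b < N \<and> 0 < cnt b \<and> cnt b < length (blk b)}"

definition filled_tv :: "(nat \<Rightarrow> nat) \<Rightarrow> (nat \<Rightarrow> real) \<Rightarrow> real" where
  "filled_tv cnt A = (\<Sum>b<N. tv (map A (take (cnt b) (blk b))))"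

text \<open>
  In the cost bound, \<open>2 K W\<close> pays for all bucket changes at earlier radii, and the last summand for those at
  the current radius, each of which costs at most \<open>2 W\<close> and uses up an unlabelled opened block.
\<close>

definition block_inv :: "real \<Rightarrow> (nat \<Rightarrow> nat) \<Rightarrow> (nat \<Rightarrow> int option) \<Rightarrow> (nat \<Rightarrow> real) \<Rightarrow> bool" where
  "block_inv W cnt lab A \<longleftrightarrow> 0 \<le> W \<and>
     (\<forall>b<N. cnt b \<le> length (blk b)) \<and>
     (\<forall>b<N. \<forall>c\<in>set (take (cnt b) (blk b)). \<bar>A c - a\<bar> \<le> W) \<and>
     (\<forall>b<N. \<forall>j. lab b = Some j \<longrightarrow> 0 < cnt b \<and> bucket W (A (blk b ! (cnt b - 1))) = j) \<and>
     inj_on lab {b \<in> opened cnt. lab b \<noteq> None} \<and>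
     card (opened cnt) \<le> K \<and>
     filled_tv cnt A \<le> real (\<Sum>b<N. cnt b) * (W / real k) + 2 * real K * W
       + 2 * real (K - card {b \<in> opened cnt. lab b = None}) * W"

lemma finite_opened [simp]: "finite (opened cnt)"
  by (simp add: opened_def)

lemma blk_nth_inj:
  assumes "b < N" "b' < N" "i < length (blk b)" "i' < length (blk b')" "blk b ! i = blk b' ! i'"
  shows "b = b' \<and> i = i'"
proof -
  have "b = b'"
    using blk_disjoint[OF assms(1,2)] assms(3-5) nth_mem by (metis disjoint_iff)
  then show ?thesis
    using blk_distinct assms nth_eq_iff_index_eq by blast
qed

lemma bucket_range:
  assumes "\<bar>v - a\<bar> \<le> W"
  shows "bucket W v \<in> {- int k..int k}"
proof (cases "W = 0")
  case False
  then have W: "0 < W"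
    using assms by linarith
  have "\<bar>(v - a) * real k\<bar> \<le> W * real k"
    using assms by (simp add: abs_mult mult_right_mono)
  then have "- real k \<le> (v - a) * real k / W" "(v - a) * real k / W \<le> real k"
    using W by (auto simp: field_simps abs_le_iff)
  then show ?thesis
    unfolding bucket_def atLeastAtMost_iff by (auto simp: le_floor_iff floor_le_iff)
qed (simp add: bucket_def)

lemma bucket_dist:
  assumes "\<bar>u - a\<bar> \<le> W" "\<bar>v - a\<bar> \<le> W" "bucket W u = bucket W v"
  shows "\<bar>u - v\<bar> \<le> W / real k"
proof (cases "W = 0")
  case False
  then have W: "0 < W"
    using assms by linarith
  have "\<bar>(u - a) * real k / W - (v - a) * real k / W\<bar> \<le> 1"
    using assms(3) unfolding bucket_def by linarith
  moreover have "(u - a) * real k / W - (v - a) * real k / W = (u - v) / (W / real k)"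
    by (simp add: algebra_simps diff_divide_distrib)
  ultimately have "\<bar>u - v\<bar> / (W / real k) \<le> 1"
    using W by (simp add: abs_divide)
  then show ?thesis
    using W k_pos by (simp add: field_simps)
qed (use assms in auto)

lemma sum_update:
  fixes f g :: "nat \<Rightarrow> 'a::ab_group_add"
  assumes "b < N" "\<And>b'. b' < N \<Longrightarrow> b' \<noteq> b \<Longrightarrow> g b' = f b'"
  shows "(\<Sum>b'<N. g b') = (\<Sum>b'<N. f b') + (g b - f b)"
proof -
  have "(\<Sum>b'\<in>{..<N} - {b}. g b') = (\<Sum>b'\<in>{..<N} - {b}. f b')"
    by (rule sum.cong) (use assms in auto)
  then show ?thesis
    using assms(1) by (simp add: sum.remove[of _ b])
qed

section \<open>Effect of one written item on the invariant\<close>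

context
  fixes W x :: real and cnt :: "nat \<Rightarrow> nat" and lab :: "nat \<Rightarrow> int option"
    and A :: "nat \<Rightarrow> real" and b :: nat
  assumes inv: "block_inv W cnt lab A" and b: "b < N" "cnt b < length (blk b)" and x: "\<bar>x - a\<bar> \<le> W"
begin

abbreviation "cnt' \<equiv> cnt(b := Suc (cnt b))"
abbreviation "A' \<equiv> A(blk b ! cnt b := x)"

lemma filled_unchanged:
  assumes "b' < N" "i < cnt b'"
  shows "A' (blk b' ! i) = A (blk b' ! i)"
proof -
  have "cnt b' \<le> length (blk b')"
    using inv assms(1) by (simp add: block_inv_def)
  then have "blk b' ! i \<noteq> blk b ! cnt b"
    using blk_nth_inj[of b' b i "cnt b"] assms b by auto
  then show ?thesis
    by simp
qed

lemma map_filled_unchanged: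
  assumes "b' < N"
  shows "map A' (take (cnt b') (blk b')) = map A (take (cnt b') (blk b'))"
  using filled_unchanged[OF assms] by (intro nth_equalityI) auto

lemma filled_bound:
  assumes "b' < N" "c \<in> set (take (cnt' b') (blk b'))"
  shows "\<bar>A' c - a\<bar> \<le> W"
proof -
  have "c = blk b ! cnt b \<or> (c \<in> set (take (cnt b') (blk b')))"
    using assms(2) b(2) by (auto simp: take_Suc_conv_app_nth split: if_splits)
  moreover have "\<bar>A c - a\<bar> \<le> W" if "c \<in> set (take (cnt b') (blk b'))"
    using inv assms(1) that by (simp add: block_inv_def)
  ultimately show ?thesis
    using x by auto
qed

text \<open>Only the filled prefix of block \<open>b\<close> grows, by the step from its last item
  to \<open>x\<close>; the first item of a block is free.\<close>

lemma filled_tv_step: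
  "filled_tv cnt' A' =
     filled_tv cnt A + (if cnt b = 0 then 0 else \<bar>x - A (blk b ! (cnt b - 1))\<bar>)"
proof -
  have "tv (map A' (take (cnt' b) (blk b))) =
      tv (map A (take (cnt b) (blk b)) @ [x])"
    using b(2) by (simp add: take_Suc_conv_app_nth map_filled_unchanged[OF b(1)] del: map_eq_conv)
  also have "\<dots> = tv (map A (take (cnt b) (blk b)))
      + (if cnt b = 0 then 0 else \<bar>x - A (blk b ! (cnt b - 1))\<bar>)"
  proof (cases "cnt b = 0")
    case False
    then have "last (map A (take (cnt b) (blk b))) = A (blk b ! (cnt b - 1))"
      using b(2) by (subst last_conv_nth) (auto simp: min_def)
    moreover have "map A (take (cnt b) (blk b)) \<noteq> []"
      using False b(2) by auto
    ultimately show ?thesis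
      using False by (simp add: tv_append)
  qed simp
  finally show ?thesis
    unfolding filled_tv_def
    by (subst sum_update[OF b(1), where f = "\<lambda>b. tv (map A (take (cnt b) (blk b)))"])
      (auto simp: map_filled_unchanged simp del: map_eq_conv)
qed

lemma sum_cnt_step: "(\<Sum>b<N. cnt' b) = Suc (\<Sum>b<N. cnt b)"
proof -
  have "(\<Sum>b<N. int (cnt' b)) = (\<Sum>b<N. int (cnt b)) + 1"
    by (subst sum_update[OF b(1), where f = "\<lambda>b. int (cnt b)"]) auto
  then show ?thesis
    by (simp only: of_nat_sum[symmetric])
qed

lemma last_dist: "0 < cnt b \<Longrightarrow> \<bar>A (blk b ! (cnt b - 1)) - a\<bar> \<le> W"
proof -
  assume "0 < cnt b"
  then have "blk b ! (cnt b - 1) \<in> set (take (cnt b) (blk b))"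
    using b(2) by (auto simp: in_set_conv_nth intro!: exI[of _ "cnt b - 1"])
  then show ?thesis
    using inv b(1) by (simp add: block_inv_def)
qed

text \<open>The last item of the block shares the bucket of \<open>x\<close>, so the new step costs
  at most \<open>W / k\<close>, which the summand for the number of filled cells pays. The set of
  unlabelled opened blocks does not change.\<close>

lemma block_inv_step_labelled:
  assumes "lab b = Some (bucket W x)"
  shows "block_inv W cnt' lab A'"
proof -
  have cnt: "0 < cnt b" and bk: "bucket W (A (blk b ! (cnt b - 1))) = bucket W x"
    using inv assms b(1) by (auto simp: block_inv_def)
  then have bo: "b \<in> opened cnt"
    using b by (simp add: opened_def)
  then have op: "opened cnt' \<subseteq> opened cnt"
    by (auto simp: opened_def split: if_splits)
  have u: "{b' \<in> opened cnt'. lab b' = None} = {b' \<in> opened cnt. lab b' = None}"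
    using assms by (auto simp: opened_def split: if_splits)
  have "\<bar>x - A (blk b ! (cnt b - 1))\<bar> \<le> W / real k"
    by (rule bucket_dist) (use x last_dist cnt bk in auto)
  then have "filled_tv cnt' A' \<le> filled_tv cnt A + W / real k"
    using cnt by (simp add: filled_tv_step)
  moreover have "filled_tv cnt A \<le> real (\<Sum>b<N. cnt b) * (W / real k) + 2 * real K * W
       + 2 * real (K - card {b \<in> opened cnt. lab b = None}) * W"
    using inv by (simp add: block_inv_def)
  moreover have "real (\<Sum>b<N. cnt' b) * (W / real k) = real (\<Sum>b<N. cnt b) * (W / real k) + W / real k"
    unfolding sum_cnt_step by (simp add: algebra_simps add_divide_distrib)
  ultimately have cost: "filled_tv cnt' A' \<le> real (\<Sum>b<N. cnt' b) * (W / real k) + 2 * real K * W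
       + 2 * real (K - card {b \<in> opened cnt'. lab b = None}) * W"
    unfolding u by linarith
  have "inj_on lab {b \<in> opened cnt'. lab b \<noteq> None}"
    by (rule inj_on_subset[of _ "{b \<in> opened cnt. lab b \<noteq> None}"]) (use inv op in \<open>auto simp: block_inv_def\<close>)
  moreover have "card (opened cnt') \<le> K"
    using card_mono[OF _ op] inv by (simp add: block_inv_def)
  moreover have "0 < cnt' b' \<and> bucket W (A' (blk b' ! (cnt' b' - 1))) = j" if "b' < N" "lab b' = Some j" for b' j
  proof (cases "b' = b")
    case False
    then have "0 < cnt b'" "bucket W (A (blk b' ! (cnt b' - 1))) = j"
      using inv that by (auto simp: block_inv_def)
    then show ?thesis
      using False filled_unchanged[OF that(1), of "cnt b' - 1"] by simp
  qed (use that assms in auto)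
  ultimately show ?thesis
    unfolding block_inv_def using inv b filled_bound cost
    by (auto simp: block_inv_def)
qed

text \<open>Taking over an opened block costs at most \<open>2 * W\<close> but removes it from the
  unlabelled opened ones, so the last summand of the bound pays. An empty block costs nothing; it is
  started only when all opened blocks are labelled.\<close>

lemma block_inv_step_relabel:
  assumes unused: "\<And>b'. b' \<in> opened cnt \<Longrightarrow> lab b' \<noteq> Some (bucket W x)"
    and None: "lab b = None"
    and fresh: "cnt b = 0 \<Longrightarrow> (\<forall>b'\<in>opened cnt. lab b' \<noteq> None)"
  shows "block_inv W cnt' (lab(b := Some (bucket W x))) A'"
proof -
  let ?lab = "lab(b := Some (bucket W x))"
  let ?u = "card {b \<in> opened cnt. lab b = None}"
  let ?u' = "card {b \<in> opened cnt'. ?lab b = None}"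
  have op: "opened cnt' \<subseteq> insert b (opened cnt)"
    by (auto simp: opened_def split: if_splits)
  have W: "0 \<le> W"
    using inv by (simp add: block_inv_def)
  have last: "0 < cnt' b' \<and> bucket W (A' (blk b' ! (cnt' b' - 1))) = j"
    if "b' < N" "?lab b' = Some j" for b' j
  proof (cases "b' = b")
    case False
    then have "0 < cnt b'" "bucket W (A (blk b' ! (cnt b' - 1))) = j"
      using inv that by (auto simp: block_inv_def)
    then show ?thesis
      using False filled_unchanged[OF that(1), of "cnt b' - 1"] by simp
  qed (use that in auto)
  have inj: "inj_on ?lab {b \<in> opened cnt'. ?lab b \<noteq> None}"
  proof -
    have "inj_on lab {b \<in> opened cnt. lab b \<noteq> None}"
      using inv by (simp add: block_inv_def)
    then show ?thesis
      using unused op unfolding inj_on_def by (auto split: if_splits)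
  qed
  have u': "{b' \<in> opened cnt'. ?lab b' = None} = {b \<in> opened cnt. lab b = None} - {b}"
    using None by (auto simp: opened_def split: if_splits)
  have K: "card (opened cnt') \<le> K"
  proof (cases "cnt b = 0")
    case True
    \<comment> \<open>Starting a block may raise the number of opened ones, but then all of them
      carry labels, which are distinct and among \<open>K\<close> buckets.\<close>
    have lab: "?lab b' \<noteq> None" if "b' \<in> opened cnt'" for b'
      using fresh[OF True] op that by auto
    have "?lab ` opened cnt' \<subseteq> Some ` {- int k..int k}"
    proof
      fix y assume "y \<in> ?lab ` opened cnt'"
      then obtain b' j where b': "b' \<in> opened cnt'" "?lab b' = Some j" "y = Some j"
        using lab by blast
      then have b'N: "b' < N" and le: "cnt' b' \<le> length (blk b')"
        by (auto simp: opened_def)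
      have j: "0 < cnt' b'" "bucket W (A' (blk b' ! (cnt' b' - 1))) = j"
        using last[OF b'N b'(2)] by auto
      have "blk b' ! (cnt' b' - 1) \<in> set (take (cnt' b') (blk b'))"
        unfolding in_set_conv_nth using j(1) le by (intro exI[of _ "cnt' b' - 1"]) auto
      then have "\<bar>A' (blk b' ! (cnt' b' - 1)) - a\<bar> \<le> W"
        by (rule filled_bound[OF b'N])
      then show "y \<in> Some ` {- int k..int k}"
        using bucket_range j(2) b'(3) by blast
    qed
    then have "card (?lab ` opened cnt') \<le> card (Some ` {- int k..int k})"
      by (intro card_mono) auto
    also have "\<dots> = K"
      by (simp add: card_image K_def)
    also have "card (?lab ` opened cnt') = card (opened cnt')"
    proof (rule card_image)
      have "{b \<in> opened cnt'. ?lab b \<noteq> None} = opened cnt'"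
        using lab by blast
      then show "inj_on ?lab (opened cnt')"
        using inj by metis
    qed
    finally show ?thesis .
  next
    case False
    then have "b \<in> opened cnt"
      using b by (simp add: opened_def)
    then have "card (opened cnt') \<le> card (opened cnt)"
      using op by (intro card_mono) auto
    then show ?thesis
      using inv by (simp add: block_inv_def)
  qed
  have "filled_tv cnt' A' \<le> filled_tv cnt A + 2 * (real (K - ?u') - real (K - ?u)) * W"
  proof (cases "cnt b = 0")
    case True
    then have "{b \<in> opened cnt. lab b = None} = {}"
      using fresh by auto
    moreover have "filled_tv cnt' A' = filled_tv cnt A"
      unfolding filled_tv_step using True by simp
    ultimately show ?thesis
      unfolding u' by simp
  next
    case False
    then have bo: "b \<in> {b \<in> opened cnt. lab b = None}"
      using b None by (simp add: opened_def)
    \<comment> \<open>Leads to \<open>?u \<le> K\<close>, so that natural subtraction does not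
      truncate and \<open>K - ?u'\<close> exceeds \<open>K - ?u\<close> by exactly one.\<close>
    have "?u \<le> card (opened cnt)"
      by (rule card_mono) auto
    then have "?u \<le> K"
      using inv by (simp add: block_inv_def)
    moreover have "?u = Suc ?u'"
      unfolding u' using bo by (intro card.remove) auto
    ultimately have u: "real (K - ?u') - real (K - ?u) = 1"
      by (simp add: of_nat_diff)
    have "\<bar>x - A (blk b ! (cnt b - 1))\<bar> \<le> 2 * W"
      using x last_dist False by linarith
    then show ?thesis
      unfolding filled_tv_step u using False by simp
  qed
  moreover have "filled_tv cnt A \<le> real (\<Sum>b<N. cnt b) * (W / real k) + 2 * real K * W
       + 2 * real (K - ?u) * W"
    using inv by (simp add: block_inv_def)
  moreover have "real (\<Sum>b<N. cnt b) * (W / real k) \<le> real (\<Sum>b<N. cnt' b) * (W / real k)"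
    unfolding sum_cnt_step using W by (intro mult_right_mono) auto
  ultimately have cost: "filled_tv cnt' A' \<le> real (\<Sum>b<N. cnt' b) * (W / real k) + 2 * real K * W
       + 2 * real (K - ?u') * W"
    by argo
  have "\<forall>b'<N. cnt' b' \<le> length (blk b')"
    using inv b by (simp add: block_inv_def)
  moreover have "\<forall>b'<N. \<forall>c\<in>set (take (cnt' b') (blk b')). \<bar>A' c - a\<bar> \<le> W"
    using filled_bound by blast
  moreover have "\<forall>b'<N. \<forall>j. ?lab b' = Some j \<longrightarrow>
      0 < cnt' b' \<and> bucket W (A' (blk b' ! (cnt' b' - 1))) = j"
    using last by blast
  ultimately show ?thesis
    unfolding block_inv_def using W inj K cost by (intro conjI)
qed

end

text \<open>The order of preference is: the opened block of the bucket of \<open>x\<close>, an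
  unlabelled opened block, and finally \<open>b0\<close>, which must then still be empty.\<close>

lemma block_inv_step:
  assumes "block_inv W cnt lab A" "\<bar>x - a\<bar> \<le> W"
    and "b0 < N" "cnt b0 < length (blk b0)" "lab b0 = None"
  shows "\<exists>b lab'. b < N \<and> cnt b < length (blk b) \<and>
    block_inv W (cnt(b := Suc (cnt b))) lab' (A(blk b ! cnt b := x))"
proof (cases "\<exists>b\<in>opened cnt. lab b = Some (bucket W x)")
  case True
  then show ?thesis
    using block_inv_step_labelled[OF assms(1) _ _ assms(2)] by (auto simp: opened_def)
next
  case unused: False
  show ?thesis
  proof (cases "\<exists>b\<in>opened cnt. lab b = None")
    case True
    then obtain b where b: "b \<in> opened cnt" "lab b = None"
      by blast
    then have "b < N" "cnt b < length (blk b)" "0 < cnt b"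
      by (auto simp: opened_def)
    moreover from this have "block_inv W (cnt(b := Suc (cnt b))) (lab(b := Some (bucket W x))) (A(blk b ! cnt b := x))"
      using unused b by (intro block_inv_step_relabel[OF assms(1) _ _ assms(2)]) auto
    ultimately show ?thesis
      by blast
  next
    case False
    then have "block_inv W (cnt(b0 := Suc (cnt b0))) (lab(b0 := Some (bucket W x))) (A(blk b0 ! cnt b0 := x))"
      using unused by (intro block_inv_step_relabel[OF assms(1,3,4,2) _ assms(5)]) auto
    then show ?thesis
      using assms(3,4) by blast
  qed
qed

text \<open>The two summands for bucket changes together are at most \<open>4 * K * W\<close>, which
  the summand \<open>2 * K * W'\<close> for earlier radii absorbs. The last summand starts
  anew.\<close>

lemma block_inv_rescale:
  assumes "block_inv W cnt lab A" "2 * W \<le> W'"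
  shows "block_inv W' cnt (\<lambda>_. None) A"
proof -
  have W: "0 \<le> W" "W \<le> W'"
    using assms by (auto simp: block_inv_def)
  have "filled_tv cnt A \<le> real (\<Sum>b<N. cnt b) * (W / real k) + 2 * real K * W
       + 2 * real (K - card {b \<in> opened cnt. lab b = None}) * W"
    using assms(1) by (simp add: block_inv_def)
  also have "\<dots> \<le> real (\<Sum>b<N. cnt b) * (W' / real k) + 2 * real K * W + 2 * real K * W"
    using W by (intro add_mono mult_mono) (auto simp: divide_right_mono sum_nonneg)
  also have "\<dots> \<le> real (\<Sum>b<N. cnt b) * (W' / real k) + 2 * real K * W'"
    using mult_left_mono[OF assms(2), of "2 * real K"] by simp
  finally have "filled_tv cnt A \<le> real (\<Sum>b<N. cnt b) * (W' / real k) + 2 * real K * W'" .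
  moreover have "0 \<le> 2 * real (K - card {b \<in> opened cnt. (None :: int option) = None}) * W'"
    using W by simp
  ultimately have "filled_tv cnt A \<le> real (\<Sum>b<N. cnt b) * (W' / real k) + 2 * real K * W'
     + 2 * real (K - card {b \<in> opened cnt. (None :: int option) = None}) * W'"
    by linarith
  then show ?thesis
    using assms(1) W by (force simp: block_inv_def)
qed

section \<open>Empty cells and the end of a round\<close>

lemma set_free_cells:
  "c \<in> set (free_cells cnt) \<longleftrightarrow> (\<exists>b<N. \<exists>i. cnt b \<le> i \<and> i < length (blk b) \<and> c = blk b ! i)"
proof -
  have "c \<in> set (drop n xs) \<longleftrightarrow> (\<exists>i. n \<le> i \<and> i < length xs \<and> c = xs ! i)" for n and xs :: "nat list"
  proof
    assume "\<exists>i. n \<le> i \<and> i < length xs \<and> c = xs ! i"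
    then obtain i where "n \<le> i" "i < length xs" "c = xs ! i"
      by blast
    then show "c \<in> set (drop n xs)"
      unfolding in_set_conv_nth by (intro exI[of _ "i - n"]) auto
  next
    assume "c \<in> set (drop n xs)"
    then obtain i where "i < length xs - n" "c = xs ! (n + i)"
      by (auto simp: in_set_conv_nth)
    then show "\<exists>i. n \<le> i \<and> i < length xs \<and> c = xs ! i"
      by (intro exI[of _ "n + i"]) auto
  qed
  moreover have "c \<in> set (free_cells cnt) \<longleftrightarrow> (\<exists>b<N. c \<in> set (drop (cnt b) (blk b)))"
    by (auto simp: free_cells_def)
  ultimately show ?thesis
    by simp
qed

lemma free_cells_subset: "set (free_cells cnt) \<subseteq> set cells"
  unfolding free_cells_def cells_def by (auto dest: in_set_dropD)

lemma filled_not_free: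
  assumes "block_inv W cnt lab A" "b < N" "c \<in> set (take (cnt b) (blk b))"
  shows "c \<notin> set (free_cells cnt)"
proof
  assume "c \<in> set (free_cells cnt)"
  then obtain b' i where b': "b' < N" "cnt b' \<le> i" "i < length (blk b')" "c = blk b' ! i"
    by (auto simp: set_free_cells)
  obtain j where j: "j < cnt b" "j < length (blk b)" "c = blk b ! j"
    using assms(3) by (auto simp: in_set_conv_nth)
  have "b = b' \<and> j = i"
    by (rule blk_nth_inj) (use b' j assms(2) in simp_all)
  with j(1) b'(2) show False
    by simp
qed

lemma distinct_free_cells: "distinct (free_cells cnt)"
proof -
  have "distinct (concat (map (\<lambda>b. drop (cnt b) (blk b)) [0..<M]))" if "M \<le> N" for M
    using that
  proof (induction M)
    case (Suc M)
    have "set (drop (cnt b) (blk b)) \<inter> set (drop (cnt M) (blk M)) = {}" if "b < M" for b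
      using blk_disjoint[of b M] that Suc.prems by (auto dest!: in_set_dropD)
    then show ?case
      using Suc blk_distinct[of M] by fastforce
  qed simp
  then show ?thesis
    by (simp add: free_cells_def)
qed

lemma free_cells_step:
  assumes "b < N" "cnt b < length (blk b)"
  shows "blk b ! cnt b \<in> set (free_cells cnt)"
    and "set (free_cells (cnt(b := Suc (cnt b)))) = set (free_cells cnt) - {blk b ! cnt b}"
proof -
  show "blk b ! cnt b \<in> set (free_cells cnt)"
    using assms by (auto simp: set_free_cells)
  show "set (free_cells (cnt(b := Suc (cnt b)))) = set (free_cells cnt) - {blk b ! cnt b}"
  proof (intro set_eqI iffI)
    fix c assume "c \<in> set (free_cells (cnt(b := Suc (cnt b))))"
    then obtain b' i where b': "b' < N" "(cnt(b := Suc (cnt b))) b' \<le> i" "i < length (blk b')" "c = blk b' ! i"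
      unfolding set_free_cells by blast
    moreover have "cnt b' \<le> i"
      using b'(2) by (auto split: if_splits)
    moreover have "c \<noteq> blk b ! cnt b"
      using blk_nth_inj[of b' b i "cnt b"] b' assms by auto
    ultimately show "c \<in> set (free_cells cnt) - {blk b ! cnt b}"
      by (auto simp: set_free_cells)
  next
    fix c assume c: "c \<in> set (free_cells cnt) - {blk b ! cnt b}"
    then obtain b' i where b': "b' < N" "cnt b' \<le> i" "i < length (blk b')" "c = blk b' ! i"
      by (auto simp: set_free_cells)
    then have "(cnt(b := Suc (cnt b))) b' \<le> i"
      using c by (auto simp: le_less)
    with b' show "c \<in> set (free_cells (cnt(b := Suc (cnt b))))"
      unfolding set_free_cells by blast
  qed
qed

text \<open>A labelled block contains an item, so under \<open>stuck\<close> every block with an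
  empty cell is one of the at most \<open>K\<close> opened ones.\<close>

lemma length_free_cells_le:
  assumes "block_inv W cnt lab A" and stuck: "\<And>b. b < N \<Longrightarrow> cnt b < length (blk b) \<Longrightarrow> lab b \<noteq> None"
  shows "length (free_cells cnt) \<le> K * s"
proof -
  have "length (free_cells cnt) = (\<Sum>b<N. length (blk b) - cnt b)"
    by (simp add: free_cells_def length_concat comp_def interv_sum_list_conv_sum_set_nat atLeast0LessThan)
  also have "\<dots> \<le> (\<Sum>b<N. if b \<in> opened cnt then s else 0)"
  proof (rule sum_mono)
    fix b assume "b \<in> {..<N}"
    then have b: "b < N"
      by simp
    show "length (blk b) - cnt b \<le> (if b \<in> opened cnt then s else 0)"
    proof (cases "cnt b < length (blk b)")
      case True
      then obtain j where "lab b = Some j"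
        using stuck[OF b] by blast
      then have "0 < cnt b"
        using assms(1) b by (simp add: block_inv_def)
      then show ?thesis
        using True b blk_length[OF b] by (simp add: opened_def)
    qed simp
  qed
  also have "\<dots> = card (opened cnt) * s"
  proof -
    have "{..<N} \<inter> {b. b \<in> opened cnt} = opened cnt"
      by (auto simp: opened_def)
    then show ?thesis
      by (simp add: sum.If_cases)
  qed
  also have "\<dots> \<le> K * s"
    using assms(1) by (simp add: block_inv_def)
  finally show ?thesis .
qed

text \<open>\<open>2 * N\<close> accounts for the junctions in \<open>tv_concat_le\<close> and
  \<open>C'\<close> for the recursive filling of the empty cells; the rest is the bound of the
  invariant with \<open>W \<le> 2 * D\<close>.\<close>

lemma final_cost:
  assumes inv: "block_inv W cnt lab A"
    and W: "W = 0 \<or> (\<exists>b<N. \<exists>c\<in>set (take (cnt b) (blk b)). W = 2 * \<bar>A c - a\<bar>)"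
    and B: "fills_well C' (free_cells cnt) B"
    and aB: "a \<in> override_on A B (set (free_cells cnt)) ` set cells"
  shows "fills_well (2 * real (length cells) / real k + 8 * real K + 2 * real N + C') cells
    (override_on A B (set (free_cells cnt)))"
  unfolding fills_well_def
proof (intro allI impI)
  fix D
  define T where "T = override_on A B (set (free_cells cnt))"
  assume "\<forall>c\<in>set cells. \<forall>c'\<in>set cells. \<bar>override_on A B (set (free_cells cnt)) c
    - override_on A B (set (free_cells cnt)) c'\<bar> \<le> D"
  then have D: "\<bar>T c - T c'\<bar> \<le> D" if "c \<in> set cells" "c' \<in> set cells" for c c'
    using that unfolding T_def by blast
  obtain c0 where c0: "c0 \<in> set cells" "T c0 = a"
    using aB unfolding T_def by blast
  have D0: "0 \<le> D"
    using D[OF c0(1) c0(1)] by simp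
  have filled: "T c = A c" "c \<in> set cells" if "b < N" "c \<in> set (take (cnt b) (blk b))" for b c
    using filled_not_free[OF inv that] that
    by (auto simp: T_def cells_def dest: in_set_takeD)
  \<comment> \<open>Unless it is 0, \<open>W\<close> is twice the distance of some written item from
    \<open>a\<close>. As \<open>a\<close> occurs in the array too, this distance is at most
    \<open>D\<close>.\<close>
  have WD: "W \<le> 2 * D"
    using W
  proof (elim disjE exE conjE bexE)
    fix b c assume c: "b < N" "c \<in> set (take (cnt b) (blk b))" "W = 2 * \<bar>A c - a\<bar>"
    then show ?thesis
      using D[OF filled(2)[OF c(1,2)] c0(1)] filled(1)[OF c(1,2)] c0(2) by simp
  qed (use D0 in simp)
  have W0: "0 \<le> W" and cnt: "\<And>b. b < N \<Longrightarrow> cnt b \<le> length (blk b)"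
    using inv by (auto simp: block_inv_def)
  let ?F = "\<lambda>b. map T (take (cnt b) (blk b))" and ?R = "\<lambda>b. map T (drop (cnt b) (blk b))"
  have cells_eq: "map T cells = concat (map (\<lambda>b. ?F b @ ?R b) [0..<N])"
    by (simp add: cells_def map_concat comp_def flip: map_append)
  have free_eq: "map T (free_cells cnt) = concat (map ?R [0..<N])"
    by (simp add: free_cells_def map_concat comp_def)
  have "tv (map T cells) \<le> (\<Sum>b<N. tv (?F b)) + tv (map T (free_cells cnt)) + 2 * real N * D"
    unfolding cells_eq free_eq
  proof (rule tv_concat_le[OF D0])
    fix u v
    assume "u \<in> set (concat (map (\<lambda>b. ?F b @ ?R b) [0..<N]))"
      "v \<in> set (concat (map (\<lambda>b. ?F b @ ?R b) [0..<N]))"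
    then show "\<bar>v - u\<bar> \<le> D"
      unfolding cells_eq[symmetric] using D by auto
  qed
  moreover have "(\<Sum>b<N. tv (?F b)) = filled_tv cnt A"
    unfolding filled_tv_def
  proof (intro sum.cong refl arg_cong[where f = tv])
    fix b assume "b \<in> {..<N}"
    then show "?F b = map A (take (cnt b) (blk b))"
      using filled(1)[of b] by simp
  qed
  moreover have "filled_tv cnt A \<le> 2 * real (length cells) / real k * D + 8 * real K * D"
  proof -
    have "(\<Sum>b<N. cnt b) \<le> (\<Sum>b<N. length (blk b))"
      using cnt by (intro sum_mono) auto
    also have "\<dots> = length cells"
      by (simp add: cells_def length_concat comp_def interv_sum_list_conv_sum_set_nat atLeast0LessThan)
    finally have n: "(\<Sum>b<N. cnt b) \<le> length cells" .
    have "filled_tv cnt A \<le> real (\<Sum>b<N. cnt b) * (W / real k) + 2 * real K * W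
         + 2 * real (K - card {b \<in> opened cnt. lab b = None}) * W"
      using inv by (simp add: block_inv_def)
    also have "\<dots> \<le> real (length cells) * (W / real k) + 2 * real K * W + 2 * real K * W"
      using W0 by (intro add_mono mult_right_mono of_nat_mono n) auto
    also have "\<dots> = (real (length cells) / real k + 4 * real K) * W"
      by (simp add: algebra_simps)
    also have "\<dots> \<le> (real (length cells) / real k + 4 * real K) * (2 * D)"
      using WD by (intro mult_left_mono) auto
    finally show ?thesis
      by (simp add: algebra_simps)
  qed
  moreover have "tv (map T (free_cells cnt)) \<le> C' * D"
  proof -
    have TB: "T c = B c" if "c \<in> set (free_cells cnt)" for c
      using that by (simp add: T_def)
    then have "map T (free_cells cnt) = map B (free_cells cnt)"
      by simp
    moreover have "\<forall>c\<in>set (free_cells cnt). \<forall>c'\<in>set (free_cells cnt). \<bar>B c - B c'\<bar> \<le> D"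
      using D free_cells_subset TB by (metis subsetD)
    ultimately show ?thesis
      using B D0 unfolding fills_well_def by metis
  qed
  ultimately show "tv (map (override_on A B (set (free_cells cnt))) cells)
    \<le> (2 * real (length cells) / real k + 8 * real K + 2 * real N + C') * D"
    unfolding T_def[symmetric] distrib_right by linarith
qed

text \<open>Induction on the number of empty cells. As long as some block with an empty cell has no
  label, \<open>block_inv_step\<close> writes the next item; afterwards \<open>rec\<close> takes
  over. \<open>A\<close> holds the entries written so far, and \<open>B\<close> counts only on the
  empty cells.\<close>

lemma win_from_block_inv:
  assumes rec: "\<And>es. distinct es \<Longrightarrow> length es \<le> K * s \<Longrightarrow>
      win (length es) (set es) (fills_well C' es)"
    and "block_inv W cnt lab A"
    and "W = 0 \<or> (\<exists>b<N. \<exists>c\<in>set (take (cnt b) (blk b)). W = 2 * \<bar>A c - a\<bar>)"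
    and "length (free_cells cnt) = r"
  shows "win r (set (free_cells cnt)) (\<lambda>B.
    a \<in> override_on A B (set (free_cells cnt)) ` set cells \<longrightarrow>
    fills_well (2 * real (length cells) / real k + 8 * real K + 2 * real N + C') cells
      (override_on A B (set (free_cells cnt))))"
  using assms(2-4)
proof (induction r arbitrary: W cnt lab A)
  case (0 W cnt lab A)
  have "win (length (free_cells cnt)) (set (free_cells cnt)) (fills_well C' (free_cells cnt))"
    by (rule rec) (use 0 in \<open>simp_all add: distinct_free_cells\<close>)
  then show ?case
    unfolding 0(3) by (rule win_mono) (use final_cost[OF 0(1,2)] in blast)
next
  case (Suc r W cnt lab A)
  show ?case
  proof (cases "\<exists>b<N. cnt b < length (blk b) \<and> lab b = None")
    case False
    have "win (length (free_cells cnt)) (set (free_cells cnt)) (fills_well C' (free_cells cnt))"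
      by (rule rec) (use False length_free_cells_le[OF Suc.prems(1)] in \<open>auto simp: distinct_free_cells\<close>)
    then show ?thesis
      unfolding Suc.prems(3) by (rule win_mono) (use final_cost[OF Suc.prems(1,2)] in blast)
  next
    case True
    then obtain b0 where b0: "b0 < N" "cnt b0 < length (blk b0)" "lab b0 = None"
      by blast
    show ?thesis
      unfolding win.simps
    proof
      fix x
      \<comment> \<open>If \<open>x\<close> lies outside the interval, the new radius exceeds
        \<open>2 * W\<close>, so \<open>block_inv_rescale\<close> applies and leaves
        \<open>b0\<close> unlabelled.\<close>
      let ?W = "if \<bar>x - a\<bar> \<le> W then W else 2 * \<bar>x - a\<bar>"
      have "\<exists>lab'. block_inv ?W cnt lab' A \<and> lab' b0 = None"
        using Suc.prems(1) b0(3) block_inv_rescale[OF Suc.prems(1), of ?W] by auto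
      then obtain lab' where lab': "block_inv ?W cnt lab' A" "lab' b0 = None"
        by blast
      moreover have "\<bar>x - a\<bar> \<le> ?W"
        by simp
      ultimately obtain b lab'' where b: "b < N" "cnt b < length (blk b)"
        and inv': "block_inv ?W (cnt(b := Suc (cnt b))) lab'' (A(blk b ! cnt b := x))"
        using block_inv_step b0(1,2) by blast
      define cnt' c A' where "cnt' = cnt(b := Suc (cnt b))" and "c = blk b ! cnt b"
        and "A' = A(c := x)"
      note c_free = free_cells_step[of b cnt, OF b, folded c_def cnt'_def]
      \<comment> \<open>The item that realises the radius is either an earlier one, untouched
        because \<open>c\<close> was empty, or \<open>x\<close> itself.\<close>
      have "?W = 0 \<or> (\<exists>b<N. \<exists>c\<in>set (take (cnt' b) (blk b)). ?W = 2 * \<bar>A' c - a\<bar>)"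
      proof (cases "\<bar>x - a\<bar> \<le> W")
        case True
        have "\<exists>b'<N. \<exists>c'\<in>set (take (cnt' b') (blk b')). W = 2 * \<bar>A' c' - a\<bar>"
          if b': "b' < N" "c' \<in> set (take (cnt b') (blk b'))" "W = 2 * \<bar>A c' - a\<bar>" for b' c'
        proof -
          have "c' \<noteq> c"
            using filled_not_free[OF Suc.prems(1) b'(1,2)] c_free(1) by blast
          then have "W = 2 * \<bar>A' c' - a\<bar>"
            using b'(3) by (simp add: A'_def)
          moreover have "c' \<in> set (take (cnt' b') (blk b'))"
            using b'(2) set_take_subset_set_take[of "cnt b'" "cnt' b'" "blk b'"]
            by (auto simp: cnt'_def)
          ultimately show ?thesis
            using b'(1) by blast
        qed
        then show ?thesis
          using Suc.prems(2) True by auto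
      next
        case False
        have "c \<in> set (take (cnt' b) (blk b))"
          using b(2) by (simp add: cnt'_def c_def take_Suc_conv_app_nth)
        moreover have "?W = 2 * \<bar>A' c - a\<bar>"
          using False by (simp add: A'_def)
        ultimately show ?thesis
          using b(1) by blast
      qed
      moreover have "length (free_cells cnt') = r"
      proof -
        have "card (set (free_cells cnt')) = r"
          using c_free Suc.prems(3) distinct_card[OF distinct_free_cells[of cnt]] by simp
        then show ?thesis
          using distinct_card[OF distinct_free_cells[of cnt']] by simp
      qed
      ultimately have "win r (set (free_cells cnt')) (\<lambda>B.
          a \<in> override_on A' B (set (free_cells cnt')) ` set cells \<longrightarrow>
          fills_well (2 * real (length cells) / real k + 8 * real K + 2 * real N + C') cells
            (override_on A' B (set (free_cells cnt'))))"
        using inv' by (intro Suc.IH) (simp_all only: cnt'_def c_def A'_def)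
      moreover have "override_on A' B (set (free_cells cnt'))
          = override_on A (B(c := x)) (set (free_cells cnt))" for B
        using c_free by (auto simp: override_on_def A'_def fun_eq_iff)
      ultimately show "\<exists>c\<in>set (free_cells cnt). win r (set (free_cells cnt) - {c}) (\<lambda>B.
          a \<in> override_on A (B(c := x)) (set (free_cells cnt)) ` set cells \<longrightarrow>
          fills_well (2 * real (length cells) / real k + 8 * real K + 2 * real N + C') cells
            (override_on A (B(c := x)) (set (free_cells cnt))))"
        using c_free by (intro bexI[of _ c]) simp_all
    qed
  qed
qed

lemma win_cells:
  assumes rec: "\<And>es. distinct es \<Longrightarrow> length es \<le> K * s \<Longrightarrow>
      win (length es) (set es) (fills_well C' es)"
  shows "win (length cells) (set cells) (\<lambda>B. a \<in> B ` set cells \<longrightarrow>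
    fills_well (2 * real (length cells) / real k + 8 * real K + 2 * real N + C') cells B)"
proof -
  have free: "free_cells (\<lambda>_. 0) = cells"
    by (simp add: free_cells_def cells_def)
  have "block_inv 0 (\<lambda>_. 0) (\<lambda>_. None) (\<lambda>_. 0)"
    by (simp add: block_inv_def opened_def filled_tv_def)
  from win_from_block_inv[OF rec this, where r = "length cells"]
  have "win (length cells) (set cells) (\<lambda>B.
    a \<in> override_on (\<lambda>_. 0) B (set cells) ` set cells \<longrightarrow>
    fills_well (2 * real (length cells) / real k + 8 * real K + 2 * real N + C') cells
      (override_on (\<lambda>_. 0) B (set cells)))"
    by (simp add: free)
  then show ?thesis
  proof (rule win_mono)
    fix B :: "nat \<Rightarrow> real"
    let ?B = "override_on (\<lambda>_. 0) B (set cells)"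
    assume *: "a \<in> ?B ` set cells \<longrightarrow>
      fills_well (2 * real (length cells) / real k + 8 * real K + 2 * real N + C') cells ?B"
    have "?B ` set cells = B ` set cells" "map ?B cells = map B cells"
      by (auto simp: image_iff)
    then show "a \<in> B ` set cells \<longrightarrow>
      fills_well (2 * real (length cells) / real k + 8 * real K + 2 * real N + C') cells B"
      using * unfolding fills_well_def by (simp cong: ball_cong del: map_eq_conv)
  qed
qed

end

section \<open>Recursion with blocks of about \<open>sqrt n\<close> cells\<close>

lemma fills_well_mono:
  assumes "fills_well C es B" "C \<le> C'"
  shows "fills_well C' es B"
  using assms unfolding fills_well_def by (meson mult_right_mono order_trans)

lemma concat_chunks: "concat (map (\<lambda>b. take s (drop (b * s) es)) [0..<N]) = take (N * s) es"
  by (induction N) (simp_all add: take_add add.commute[of s])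

lemma disjoint_chunks:
  assumes "distinct es" "b < b'"
  shows "set (take s (drop (b * s) es)) \<inter> set (take s (drop (b' * s) es)) = {}"
proof -
  have "b * s + s \<le> b' * s"
    using assms(2) mult_le_mono1[of "Suc b" b' s] by simp
  then have "set (take s (drop (b' * s) es)) \<subseteq> set (drop (b * s + s) es)"
    using set_drop_subset_set_drop[of "b * s + s" "b' * s" es] by (auto dest: in_set_takeD)
  moreover have "set (take s (drop (b * s) es)) \<subseteq> set (take (b * s + s) es)"
    by (simp add: take_add)
  moreover have "set (take (b * s + s) es) \<inter> set (drop (b * s + s) es) = {}"
    using assms(1) by (simp add: set_take_disj_set_drop_if_distinct)
  ultimately show ?thesis
    by blast
qed

text \<open>One round costs \<open>O(sqrt n)\<close> times the spread and leaves at most half of the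
  cells to the recursive call, so the costs of the rounds form a geometric series.\<close>

lemma win_sqrt:
  "distinct es \<Longrightarrow> win (length es) (set es) (fills_well (500 * sqrt (real (length es))) es)"
proof (induction "length es" arbitrary: es rule: less_induct)
  case (less es)
  define n where "n = length es"
  show ?case
  proof (cases "n < 64")
    case True
    \<comment> \<open>Here \<open>n \<le> 8 * sqrt n\<close>, so any order of filling will do. The
      threshold 64 makes \<open>k\<close> positive in the other case.\<close>
    show ?thesis
    proof (rule win_any)
      fix B
      show "fills_well (500 * sqrt (real (length es))) es B"
        unfolding fills_well_def
      proof (intro allI impI)
        fix D :: real assume D: "0 \<le> D" "\<forall>c\<in>set es. \<forall>c'\<in>set es. \<bar>B c - B c'\<bar> \<le> D"
        have "tv (map B es) \<le> real n * D"
          using tv_le_length[of D "map B es"] D by (auto simp: n_def)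
        also have "real n \<le> 500 * sqrt (real n)"
        proof -
          have "sqrt (real n) \<le> sqrt 64"
            using True by (intro real_sqrt_le_mono) simp
          then have "sqrt (real n) * sqrt (real n) \<le> 500 * sqrt (real n)"
            by (intro mult_right_mono) (auto simp: real_sqrt_eq_iff)
          then show ?thesis
            by simp
        qed
        then have "real n * D \<le> 500 * sqrt (real n) * D"
          using D(1) by (rule mult_right_mono)
        finally show "tv (map B es) \<le> 500 * sqrt (real (length es)) * D"
          by (simp add: n_def)
      qed
    qed (use less.prems distinct_card in auto)
  next
    case False
    define s where "s = nat \<lfloor>sqrt (real n)\<rfloor>"
    \<comment> \<open>Chosen so that \<open>K = 2 * k + 1\<close> is at most \<open>s / 2\<close>;
      then \<open>K * s\<close> is at most half of \<open>n\<close>.\<close>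
    define k where "k = s div 8"
    define N where "N = n div s + 1"
    let ?blk = "\<lambda>b. take s (drop (b * s) es)"
    have "sqrt 64 \<le> sqrt (real n)"
      using False by (intro real_sqrt_le_mono) simp
    then have sqrt8: "8 \<le> sqrt (real n)"
      by simp
    have s_le: "real s \<le> sqrt (real n)" and s_gt: "sqrt (real n) < real s + 1"
      unfolding s_def using sqrt8 by linarith+
    have s8: "8 \<le> s"
      unfolding s_def using sqrt8 by (simp add: le_nat_iff le_floor_iff)
    have k: "0 < k" "s \<le> 16 * k" "4 * k + 2 \<le> s"
    proof -
      have "8 * k \<le> s" "s < 8 * k + 8"
        unfolding k_def by simp linarith
      moreover from this have "1 \<le> k"
        using s8 by linarith
      ultimately show "0 < k" "s \<le> 16 * k" "4 * k + 2 \<le> s"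
        by linarith+
    qed
    have s_sq: "s * s \<le> n"
    proof -
      have "real s * real s \<le> sqrt (real n) * sqrt (real n)"
        using s_le by (intro mult_mono) auto
      then show ?thesis
        by (simp flip: of_nat_mult)
    qed
    have n_le: "real n \<le> 4 * real s * real s"
    proof -
      have "sqrt (real n) * sqrt (real n) \<le> (2 * real s) * (2 * real s)"
        using s_gt s8 by (intro mult_mono) auto
      then show ?thesis
        by simp
    qed
    have "n \<le> N * s"
      using s8 unfolding N_def by (metis add.commute add_mult_distrib2 div_mult_mod_eq
          less_or_eq_imp_le mod_less_divisor mult.commute nat_add_left_cancel_le nat_mult_1_right
          order_less_le_trans zero_less_numeral)
    then have chunks: "concat (map ?blk [0..<N]) = es"
      by (simp add: concat_chunks n_def)
    have win: "win n (set es) (\<lambda>B. a \<in> B ` set es \<longrightarrow> fills_well (500 * sqrt (real n)) es B)" for a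
    proof -
      interpret blocks ?blk N s k a
      proof
        show "distinct (?blk b)" for b
          using less.prems by simp
        show "set (?blk b) \<inter> set (?blk b') = {}" if "b \<noteq> b'" for b b'
          using disjoint_chunks[OF less.prems] that by (metis inf_commute nat_neq_iff)
      qed (use k in auto)
      have cells: "cells = es"
        unfolding cells_def by (rule chunks)
      have Ks: "2 * (K * s) \<le> n"
      proof -
        have "2 * (K * s) \<le> s * s"
          using k(3) mult_le_mono1[of "4 * k + 2" s s] by (simp add: K_def algebra_simps)
        then show ?thesis
          using s_sq by (rule le_trans)
      qed
      let ?C = "500 * sqrt (real (K * s))"
      have "win (length es') (set es') (fills_well ?C es')" if "distinct es'" "length es' \<le> K * s" for es'
      proof -
        have "length es' < length es"
          using that(2) Ks False by (simp add: n_def)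
        from less.hyps[OF this that(1)] show ?thesis
          by (rule win_mono) (rule fills_well_mono, use that(2) in \<open>auto simp del: of_nat_mult\<close>)
      qed
      from win_cells[OF this]
      have "win n (set es) (\<lambda>B. a \<in> B ` set es \<longrightarrow>
          fills_well (2 * real n / real k + 8 * real K + 2 * real N + ?C) es B)"
        unfolding cells n_def by blast
      \<comment> \<open>The summands are at most \<open>128 * s\<close>, \<open>4 * s\<close>,
        \<open>10 * s\<close> and \<open>355 * sqrt n\<close>, which gives
        \<open>497 * sqrt n\<close> in total.\<close>
      moreover have "2 * real n / real k + 8 * real K + 2 * real N + ?C \<le> 500 * sqrt (real n)"
      proof -
        have "real n / real k \<le> 64 * real s"
        proof -
          have "real s * real s \<le> 16 * real k * real s"
            using k(2) by (intro mult_right_mono) auto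
          then have "real n \<le> 64 * real s * real k"
            using n_le by (simp add: mult_ac)
          then show ?thesis
            using k(1) by (simp add: field_simps)
        qed
        moreover have "real K \<le> real s / 2"
          using k(3) unfolding K_def by linarith
        moreover have "real N \<le> 5 * real s"
        proof -
          have "real (n div s) \<le> real n / real s"
            by (rule of_nat_div_le_of_nat)
          also have "\<dots> \<le> 4 * real s"
            using n_le s8 by (simp add: field_simps)
          finally show ?thesis
            using s8 by (simp add: N_def)
        qed
        moreover have "?C \<le> 355 * sqrt (real n)"
        proof -
          \<comment> \<open>\<open>71 / 100\<close> is an upper bound for
            \<open>sqrt (1 / 2)\<close>.\<close>
          have "sqrt (real (K * s)) \<le> sqrt ((71 / 100)\<^sup>2 * real n)"
            using Ks by (intro real_sqrt_le_mono) (simp add: power2_eq_square field_simps flip: of_nat_mult)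
          also have "\<dots> = 71 / 100 * sqrt (real n)"
            by (simp add: real_sqrt_mult)
          finally show ?thesis
            by simp
        qed
        ultimately show ?thesis
          using s_le by simp
      qed
      ultimately show ?thesis
        using win_mono fills_well_mono by (smt (verit))
    qed
    obtain m where m: "length es = Suc m"
      using False by (cases "length es") (auto simp: n_def)
    have "win (Suc m) (set es) (fills_well (500 * sqrt (real n)) es)"
      by (rule win_first_item) (use win in \<open>simp only: n_def m\<close>)
    then show ?thesis
      by (simp only: n_def m)
  qed
qed

lemma sqrt_competitive_alg:
  "\<exists>A. online_alg UNIV n A \<and> (\<forall>xs\<in>inputs UNIV n. \<forall>D\<ge>0.
     (\<forall>u\<in>set xs. \<forall>v\<in>set xs. \<bar>u - v\<bar> \<le> D) \<longrightarrow> alg_cost A xs \<le> 500 * sqrt (real n) * D)"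
proof -
  have "win n {..<n} (fills_well (500 * sqrt (real n)) [0..<n])"
    using win_sqrt[of "[0..<n]"] by (simp add: atLeast0LessThan)
  from win_imp_alg[OF this] obtain A where A: "\<And>xs j. length xs = n \<Longrightarrow> j < n \<Longrightarrow>
      placement A xs j \<in> {..<n} - placement A xs ` {..<j}"
    and AP: "\<And>xs B. length xs = n \<Longrightarrow> (\<forall>j<n. B (placement A xs j) = xs ! j) \<Longrightarrow>
      fills_well (500 * sqrt (real n)) [0..<n] B"
    by blast
  have alg: "online_alg UNIV n A"
    using A by (simp add: online_alg_def inputs_def)
  moreover have "alg_cost A xs \<le> 500 * sqrt (real n) * D"
    if xs: "xs \<in> inputs UNIV n" and D: "0 \<le> D" "\<forall>u\<in>set xs. \<forall>v\<in>set xs. \<bar>u - v\<bar> \<le> D" for xs D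
  proof -
    have len: "length xs = n"
      using xs by (simp add: inputs_def)
    have bij: "bij_betw (placement A xs) {..<n} {..<n}"
      by (rule online_alg_bij_betw[OF alg xs])
    have fill: "fill xs (placement A xs) (placement A xs j) = xs ! j" if "j < n" for j
      using bij that by (simp add: fill_def len the_inv_into_f_f bij_betw_def)
    have "fills_well (500 * sqrt (real n)) [0..<n] (fill xs (placement A xs))"
      by (rule AP[OF len]) (use fill in blast)
    moreover have "fill xs (placement A xs) c \<in> set xs" if "c < n" for c
    proof -
      have "c \<in> placement A xs ` {..<n}"
        using bij that by (simp add: bij_betw_def)
      then obtain j where "j < n" "c = placement A xs j"
        by blast
      then show ?thesis
        using fill len by simp
    qed
    ultimately show ?thesis
      using D unfolding fills_well_def alg_cost_def len tv_map_upt by simp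
  qed
  ultimately show ?thesis
    by blast
qed

section \<open>The lower bound\<close>

text \<open>The array after the items \<open>p\<close>. Through \<open>rev\<close> the latest write
  takes precedence, so that appending an item is a map update for any \<open>A\<close>.\<close>

definition partial_array :: "det_alg \<Rightarrow> real list \<Rightarrow> nat \<Rightarrow> real option" where
  "partial_array A p = map_of (rev (map (\<lambda>j. (placement A p j, p ! j)) [0..<length p]))"

lemma placement_append: "j < length p \<Longrightarrow> placement A (p @ q) j = placement A p j"
  by (simp add: placement_def)

lemma partial_array_Nil [simp]: "partial_array A [] = Map.empty"
  by (simp add: partial_array_def)

lemma partial_array_snoc: "partial_array A (p @ [v]) = (partial_array A p)(A (p @ [v]) \<mapsto> v)"
proof -
  have "map (\<lambda>j. (placement A (p @ [v]) j, (p @ [v]) ! j)) [0..<length p]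
      = map (\<lambda>j. (placement A p j, p ! j)) [0..<length p]"
    by (simp add: placement_append nth_append)
  moreover have "placement A (p @ [v]) (length p) = A (p @ [v])"
    by (simp add: placement_def)
  ultimately show ?thesis
    by (simp add: partial_array_def del: map_eq_conv)
qed

lemma partial_array_eq_None: "partial_array A p c = None \<longleftrightarrow> c \<notin> placement A p ` {..<length p}"
  by (simp add: partial_array_def map_of_eq_None_iff image_image atLeast0LessThan)

section \<open>Potential of a partially filled array\<close>

fun edge :: "real \<Rightarrow> real option \<Rightarrow> real option \<Rightarrow> real" where
  "edge l None None = 0"
| "edge l (Some u) None = 1"
| "edge l None (Some u) = 1"
| "edge l (Some u) (Some v) = l * \<bar>v - u\<bar>"

text \<open>For \<open>l = 0\<close> this counts the adjacent pairs of an occupied and an empty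
  cell; on a full array it is \<open>l\<close> times the cost.\<close>

definition potential :: "real \<Rightarrow> nat \<Rightarrow> (nat \<Rightarrow> real option) \<Rightarrow> real" where
  "potential l n f = (\<Sum>i<n - 1. edge l (f i) (f (Suc i)))"

definition boundary_values :: "nat \<Rightarrow> (nat \<Rightarrow> real option) \<Rightarrow> real set" where
  "boundary_values n f = {v. \<exists>i<n - 1. f i = Some v \<and> f (Suc i) = None
     \<or> f i = None \<and> f (Suc i) = Some v}"

lemma card_boundary_values: "real (card (boundary_values n f)) \<le> potential 0 n f"
  and finite_boundary_values: "finite (boundary_values n f)"
proof -
  let ?I = "{i. i < n - 1 \<and> (f i = None) \<noteq> (f (Suc i) = None)}"
  let ?v = "\<lambda>i. case f i of Some v \<Rightarrow> v | None \<Rightarrow> the (f (Suc i))"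
  have sub: "boundary_values n f \<subseteq> ?v ` ?I"
    unfolding boundary_values_def by (force simp: image_iff)
  then show "finite (boundary_values n f)"
    by (rule finite_subset) simp
  have "card (boundary_values n f) \<le> card ?I"
    using card_mono[OF _ sub] card_image_le[of ?I ?v] by simp
  moreover have "potential 0 n f = (\<Sum>i<n - 1. if (f i = None) \<noteq> (f (Suc i) = None) then 1 else 0)"
    unfolding potential_def
  proof (rule sum.cong)
    fix i
    show "edge 0 (f i) (f (Suc i)) = (if (f i = None) \<noteq> (f (Suc i) = None) then 1 else 0)"
      by (cases "f i"; cases "f (Suc i)") simp_all
  qed simp
  moreover have "\<dots> = real (card ?I)"
    by (simp add: sum.If_cases Int_def)
  ultimately show "real (card (boundary_values n f)) \<le> potential 0 n f"
    by simp
qed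

text \<open>Cell \<open>c\<close> lies in one or two adjacent pairs. If \<open>v\<close> is no
  boundary value, each of them gains at least 1: next to an empty cell 0 becomes 1, next to an item
  1 becomes at least 2. Otherwise each loses at most 1, so the total change is at least
  \<open>- 2 = 1 - 3\<close>.\<close>

lemma potential_step:
  assumes "2 \<le> n" "c < n" "f c = None" "0 \<le> l"
    and sep: "\<And>i u. f i = Some u \<Longrightarrow> u \<noteq> v \<Longrightarrow> 2 \<le> l * \<bar>v - u\<bar>"
  shows "potential l n f + 1 - (if v \<in> boundary_values n f then 3 else 0) \<le> potential l n (f(c \<mapsto> v))"
proof -
  let ?g = "f(c \<mapsto> v)"
  let ?d = "\<lambda>i. edge l (?g i) (?g (Suc i)) - edge l (f i) (f (Suc i))"
  let ?I = "{i. i < n - 1 \<and> (i = c \<or> Suc i = c)}"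
  have fin: "finite ?I"
    by simp
  have "potential l n ?g - potential l n f = (\<Sum>i<n - 1. ?d i)"
    by (simp add: potential_def sum_subtractf)
  also have "\<dots> = (\<Sum>i\<in>?I. ?d i)"
    by (rule sum.mono_neutral_right) auto
  finally have diff: "potential l n ?g - potential l n f = (\<Sum>i\<in>?I. ?d i)" .
  have "?I \<subseteq> {c, c - 1}"
    by auto
  then have "card ?I \<le> card {c, c - 1}"
    by (rule card_mono[rotated]) simp
  also have "\<dots> \<le> 2"
    by (simp add: card_insert_if)
  finally have I2: "real (card ?I) \<le> 2"
    by simp
  have "?I \<noteq> {}"
  proof (cases "c < n - 1")
    case False
    then have "c - 1 \<in> ?I"
      using assms(1,2) by auto
    then show ?thesis
      by blast
  qed auto
  then have I1: "1 \<le> real (card ?I)"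
    using fin by (simp add: card_gt_0_iff Suc_le_eq)
  have sep': "l * \<bar>u - v\<bar> \<ge> 2" if "f i = Some u" "u \<noteq> v" for i u
    using sep[OF that] by (simp add: abs_minus_commute)
  show ?thesis
  proof (cases "v \<in> boundary_values n f")
    case True
    have "- 1 \<le> ?d i" if "i \<in> ?I" for i
      using that assms(3,4)
      by (cases "f i"; cases "f (Suc i)") (auto simp: mult_nonneg_nonneg)
    then have "(\<Sum>i\<in>?I. - 1) \<le> (\<Sum>i\<in>?I. ?d i)"
      by (rule sum_mono)
    then show ?thesis
      using diff I2 True by simp
  next
    case False
    have "1 \<le> ?d i" if i: "i \<in> ?I" for i
    proof (cases "i = c")
      case True
      show ?thesis
      proof (cases "f (Suc i)")
        case (Some u)
        then have "u \<noteq> v"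
          using False True i assms(3) by (auto simp: boundary_values_def)
        then show ?thesis
          using sep'[OF Some] True Some assms(3) by simp
      qed (use True assms(3) in simp)
    next
      case ne: False
      then have Si: "Suc i = c"
        using i by simp
      show ?thesis
      proof (cases "f i")
        case (Some u)
        then have "u \<noteq> v"
          using False Si i assms(3) by (auto simp: boundary_values_def)
        then show ?thesis
          using sep[OF Some] Si Some assms(3) ne by auto
      qed (use Si ne assms(3) in auto)
    qed
    then have "(\<Sum>i\<in>?I. 1) \<le> (\<Sum>i\<in>?I. ?d i)"
      by (rule sum_mono)
    then show ?thesis
      using diff I1 False by simp
  qed
qed

text \<open>Splitting off the last letter amounts to conditioning on the first \<open>t\<close>
  random items.\<close>

lemma sum_lists_Suc:
  "(\<Sum>p | set p \<subseteq> V \<and> length p = Suc t. f p) =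
     (\<Sum>p | set p \<subseteq> V \<and> length p = t. \<Sum>v\<in>V. f (p @ [v]))" (is "?l = ?r")
proof -
  have "bij_betw (\<lambda>(p, v). p @ [v]) ({p. set p \<subseteq> V \<and> length p = t} \<times> V)
      {p. set p \<subseteq> V \<and> length p = Suc t}"
  proof (rule bij_betwI[where g = "\<lambda>p. (butlast p, last p)"])
    show "(\<lambda>p. (butlast p, last p)) \<in> {p. set p \<subseteq> V \<and> length p = Suc t}
        \<rightarrow> {p. set p \<subseteq> V \<and> length p = t} \<times> V"
      by (auto dest: in_set_butlastD last_in_set[of _]) (metis last_in_set length_0_conv nat.distinct(1) subsetD)
  qed (auto, metis append_butlast_last_id length_0_conv nat.distinct(1))
  from sum.reindex_bij_betw[OF this, of f] show ?thesis
    by (simp add: sum.cartesian_product case_prod_unfold)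
qed

section \<open>Random items followed by zeros, against a fixed algorithm\<close>

locale oblivious_adversary =
  fixes S :: "real set" and n :: nat and A :: det_alg and m :: nat
  assumes S: "{0..1} \<subseteq> S" and n: "2 \<le> n" and m: "0 < m" and alg: "online_alg S n A"
begin

text \<open>Neighbouring points are \<open>1 / (2 * m)\<close> apart, so adjacent distinct items
  contribute at least 2 to the potential with \<open>l = 4 * m\<close>. All points are at least
  \<open>1 / 2\<close> away from the padding zeros.\<close>

definition V :: "real set" where
  "V = (\<lambda>i. 1 / 2 + real i / (2 * real m)) ` {..<m}"

abbreviation words :: "nat \<Rightarrow> real list set" where
  "words t \<equiv> {p. set p \<subseteq> V \<and> length p = t}"

lemma V_bounds: "v \<in> V \<Longrightarrow> 1 / 2 \<le> v \<and> v \<le> 1"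
  using m by (auto simp: V_def field_simps)

lemma finite_V [simp]: "finite V"
  by (simp add: V_def)

lemma card_V: "card V = m"
proof -
  have "inj_on (\<lambda>i. 1 / 2 + real i / (2 * real m)) {..<m}"
    using m by (simp add: inj_on_def)
  then show ?thesis
    by (simp add: V_def card_image)
qed

lemma V_separated:
  assumes "u \<in> V" "v \<in> V" "u \<noteq> v"
  shows "2 \<le> 4 * real m * \<bar>v - u\<bar>"
proof -
  obtain i j where ij: "u = 1 / 2 + real i / (2 * real m)" "v = 1 / 2 + real j / (2 * real m)"
    using assms(1,2) by (auto simp: V_def)
  then have "i \<noteq> j"
    using assms(3) by auto
  then have "1 \<le> \<bar>real j - real i\<bar>"
    by linarith
  moreover have "v - u = (real j - real i) / (2 * real m)"
    using ij by (simp add: diff_divide_distrib)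
  ultimately show ?thesis
    using m by (simp add: abs_divide)
qed

lemma finite_words [simp]: "finite (words t)"
  using finite_lists_length_eq[OF finite_V] .

lemma card_words: "card (words t) = m ^ t"
  using card_lists_length_eq[OF finite_V] card_V by simp

definition pad :: "real list \<Rightarrow> real list" where
  "pad p = p @ replicate (n - length p) 0"

lemma pad_inputs:
  assumes "set p \<subseteq> V" "length p \<le> n"
  shows "pad p \<in> inputs {0..1} n" "pad p \<in> inputs S n"
proof -
  show "pad p \<in> inputs {0..1} n"
    using assms V_bounds by (force simp: inputs_def pad_def)
  then show "pad p \<in> inputs S n"
    using S by (auto simp: inputs_def)
qed

text \<open>The algorithm treats the prefix \<open>p\<close> of \<open>pad p\<close> as it treats
  \<open>p\<close> alone; the cells still empty after \<open>p\<close> receive the zeros.\<close>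

lemma partial_array_pad:
  assumes p: "set p \<subseteq> V" "length p \<le> n" and c: "c < n"
  shows "partial_array A p c = Some (fill (pad p) (placement A (pad p)) c)
    \<and> fill (pad p) (placement A (pad p)) c \<in> V
    \<or> partial_array A p c = None \<and> fill (pad p) (placement A (pad p)) c = 0"
proof -
  have bij: "bij_betw (placement A (pad p)) {..<n} {..<n}"
    by (rule online_alg_bij_betw[OF alg pad_inputs(2)[OF p]])
  have len: "length (pad p) = n"
    using p by (simp add: pad_def)
  have "c \<in> placement A (pad p) ` {..<n}"
    using bij c by (simp add: bij_betw_def)
  then obtain j where j: "j < n" "c = placement A (pad p) j"
    by blast
  then have fill: "fill (pad p) (placement A (pad p)) c = pad p ! j"
    using bij by (simp add: fill_def len the_inv_into_f_f bij_betw_def)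
  have inj: "placement A (pad p) i = placement A (pad p) j \<longleftrightarrow> i = j" if "i < n" for i
    using bij j(1) that by (auto simp: bij_betw_def dest: inj_onD)
  have pl: "placement A p i = placement A (pad p) i" if "i < length p" for i
    using that by (simp add: pad_def placement_append)
  show ?thesis
  proof (cases "j < length p")
    case True
    have "inj_on (placement A (pad p)) {..<length p}"
      using bij p(2) by (auto simp: bij_betw_def intro: inj_on_subset)
    then have "distinct (map (placement A p) [0..<length p])"
      using pl by (auto simp: distinct_map inj_on_def)
    then have "distinct (map fst (rev (map (\<lambda>j. (placement A p j, p ! j)) [0..<length p])))"
      by (simp add: rev_map[symmetric] comp_def)
    moreover have "(c, p ! j) \<in> set (rev (map (\<lambda>j. (placement A p j, p ! j)) [0..<length p]))"
      using True j(2) pl by auto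
    ultimately have "partial_array A p c = Some (p ! j)"
      unfolding partial_array_def by (rule map_of_is_SomeI)
    moreover have "pad p ! j = p ! j" "p ! j \<in> V"
      using True p(1) by (auto simp: pad_def nth_append)
    ultimately show ?thesis
      by (simp add: fill)
  next
    case False
    have "c \<notin> placement A p ` {..<length p}"
    proof
      assume "c \<in> placement A p ` {..<length p}"
      then obtain i where "i < length p" "c = placement A p i"
        by blast
      then show False
        using inj[of i] pl[of i] j(2) False p(2) by simp
    qed
    then show ?thesis
      using False j(1) fill by (simp add: partial_array_eq_None pad_def nth_append)
  qed
qed

text \<open>In the final array, a boundary pair consists of a zero and an item of at least
  \<open>1 / 2\<close>.\<close>

lemma boundary_le_cost:
  assumes p: "set p \<subseteq> V" "length p \<le> n"
  shows "potential 0 n (partial_array A p) \<le> 2 * alg_cost A (pad p)"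
proof -
  let ?B = "fill (pad p) (placement A (pad p))"
  have "edge 0 (partial_array A p i) (partial_array A p (Suc i)) \<le> 2 * \<bar>?B (Suc i) - ?B i\<bar>" if "i < n - 1" for i
  proof -
    have "i < n" "Suc i < n"
      using that by auto
    from partial_array_pad[OF p this(1)] partial_array_pad[OF p this(2)] show ?thesis
      using V_bounds[of "?B i"] V_bounds[of "?B (Suc i)"] by auto
  qed
  then have "potential 0 n (partial_array A p) \<le> (\<Sum>i<n - 1. 2 * \<bar>?B (Suc i) - ?B i\<bar>)"
    unfolding potential_def by (intro sum_mono) auto
  also have "\<dots> = 2 * alg_cost A (pad p)"
    using p by (simp add: alg_cost_def array_cost_def sum_distrib_left pad_def)
  finally show ?thesis .
qed

lemma potential_full:
  assumes p: "p \<in> words n"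
  shows "potential l n (partial_array A p) = l * alg_cost A (pad p)"
proof -
  let ?B = "fill (pad p) (placement A (pad p))"
  have pad: "pad p = p" and len: "length p = n" and V: "set p \<subseteq> V"
    using p by (auto simp: pad_def)
  have "p \<in> inputs S n"
    using pad_inputs(2)[of p] V len pad by simp
  then have "bij_betw (placement A p) {..<n} {..<n}"
    by (rule online_alg_bij_betw[OF alg])
  then have "partial_array A p c \<noteq> None" if "c < n" for c
    using that by (simp add: partial_array_eq_None len bij_betw_def)
  then have partial_array: "partial_array A p c = Some (?B c)" if "c < n" for c
    using partial_array_pad[OF V eq_refl[OF len] that] that by blast
  have "potential l n (partial_array A p) = (\<Sum>i<n - 1. l * \<bar>?B (Suc i) - ?B i\<bar>)"
    unfolding potential_def by (intro sum.cong) (auto simp: partial_array)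
  also have "\<dots> = l * alg_cost A (pad p)"
    by (simp add: alg_cost_def array_cost_def sum_distrib_left pad len)
  finally show ?thesis .
qed

lemma partial_array_values: "partial_array A p c = Some u \<Longrightarrow> u \<in> set p"
proof -
  assume "partial_array A p c = Some u"
  then have "(c, u) \<in> set (rev (map (\<lambda>j. (placement A p j, p ! j)) [0..<length p]))"
    unfolding partial_array_def by (rule map_of_SomeD)
  then show ?thesis
    by auto
qed

text \<open>At most \<open>potential 0\<close> many values of the next item are boundary values.
  Divided by \<open>m\<close>, the inequality bounds the conditional expectation of the next
  potential.\<close>

lemma sum_potential_step:
  assumes p: "p \<in> words t" and t: "t < n"
  shows "real m * potential (4 * real m) n (partial_array A p) + real m - 3 * potential 0 n (partial_array A p)
    \<le> (\<Sum>v\<in>V. potential (4 * real m) n (partial_array A (p @ [v])))"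
proof -
  let ?b = "boundary_values n (partial_array A p)"
  have step: "potential (4 * real m) n (partial_array A p) + 1 - (if v \<in> ?b then 3 else 0)
      \<le> potential (4 * real m) n (partial_array A (p @ [v]))" if v: "v \<in> V" for v
    unfolding partial_array_snoc
  proof (rule potential_step[OF n])
    have pv: "set (p @ [v]) \<subseteq> V" "length (p @ [v]) \<le> n"
      using p t v by auto
    have "placement A (pad (p @ [v])) t \<in> {..<n} - placement A (pad (p @ [v])) ` {..<t}"
      using alg pad_inputs(2)[OF pv] t by (simp add: online_alg_def)
    moreover have "placement A (pad (p @ [v])) j = placement A (p @ [v]) j" if "j \<le> t" for j
      unfolding pad_def using that p by (intro placement_append) simp
    moreover have "placement A (p @ [v]) j = placement A p j" if "j < t" for j
      using that p by (intro placement_append) simp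
    moreover have "placement A (p @ [v]) t = A (p @ [v])"
      using p by (simp add: placement_def)
    ultimately have "A (p @ [v]) \<in> {..<n} - placement A p ` {..<t}"
      by simp
    then show "A (p @ [v]) < n" "partial_array A p (A (p @ [v])) = None"
      using p by (auto simp: partial_array_eq_None)
    show "2 \<le> 4 * real m * \<bar>v - u\<bar>" if "partial_array A p i = Some u" "u \<noteq> v" for i u
      using V_separated[of u v] partial_array_values[OF that(1)] that(2) p v by auto
  qed simp
  have "(\<Sum>v\<in>V. if v \<in> ?b then 3 else 0) = 3 * real (card (V \<inter> ?b))"
    by (simp add: sum.If_cases)
  also have "\<dots> \<le> 3 * real (card ?b)"
    by (simp add: card_mono finite_boundary_values)
  also have "\<dots> \<le> 3 * potential 0 n (partial_array A p)"
    using card_boundary_values by simp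
  finally have "(\<Sum>v\<in>V. if v \<in> ?b then 3 else 0) \<le> 3 * potential 0 n (partial_array A p)" .
  moreover have "(\<Sum>v\<in>V. potential (4 * real m) n (partial_array A p) + 1 - (if v \<in> ?b then 3 else 0))
      \<le> (\<Sum>v\<in>V. potential (4 * real m) n (partial_array A (p @ [v])))"
    by (rule sum_mono) (rule step)
  ultimately show ?thesis
    by (simp add: sum_subtractf card_V algebra_simps)
qed

text \<open>\<open>1 / m ^ t\<close> is the probability of a word of length \<open>t\<close>. The
  other factor is \<open>4 * m\<close> from the potential of the full array, or
  \<open>6 / m\<close>, twice the coefficient \<open>3 / m\<close> of the expected number of
  boundary pairs.\<close>

definition weight :: "nat \<Rightarrow> real" where
  "weight t = (if t = n then 4 * real m else 6 / real m) / real m ^ t"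

lemma weighted_cost_ge:
  "real n \<le> (\<Sum>t\<le>n. \<Sum>p\<in>words t. weight t * alg_cost A (pad p))"
proof -
  \<comment> \<open>\<open>a t\<close> and \<open>b t\<close> are the expected potential and the
    expected number of boundary pairs after \<open>t\<close> random items.\<close>
  define a where "a t = (\<Sum>p\<in>words t. potential (4 * real m) n (partial_array A p)) / real m ^ t" for t
  define b where "b t = (\<Sum>p\<in>words t. potential 0 n (partial_array A p)) / real m ^ t" for t
  have step: "a t + 1 - 3 / real m * b t \<le> a (Suc t)" if "t < n" for t
  proof -
    have "(\<Sum>p\<in>words t. real m * potential (4 * real m) n (partial_array A p) + real m - 3 * potential 0 n (partial_array A p))
        \<le> (\<Sum>p\<in>words (Suc t). potential (4 * real m) n (partial_array A p))"
      unfolding sum_lists_Suc by (rule sum_mono) (rule sum_potential_step[OF _ that])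
    moreover have "(\<Sum>p\<in>words t. real m * potential (4 * real m) n (partial_array A p) + real m - 3 * potential 0 n (partial_array A p))
        = real m ^ Suc t * (a t + 1 - 3 / real m * b t)"
      using m by (simp add: a_def b_def sum_subtractf sum.distrib card_words field_simps
          flip: sum_distrib_left)
    ultimately have "real m ^ Suc t * (a t + 1 - 3 / real m * b t) \<le> real m ^ Suc t * a (Suc t)"
      using m by (simp add: a_def)
    then show ?thesis
      using m by (simp only: mult_le_cancel_left_pos zero_less_power of_nat_0_less_iff)
  qed
  have "real t - 3 / real m * (\<Sum>i<t. b i) \<le> a t" if "t \<le> n" for t
    using that
  proof (induction t)
    case 0
    show ?case
      by (simp add: a_def potential_def)
  next
    case (Suc t)
    then show ?case
      using step[of t] by (simp add: distrib_left)
  qed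
  then have "real n \<le> a n + 3 / real m * (\<Sum>t<n. b t)"
    by (simp add: algebra_simps)
  also have "a n = (\<Sum>p\<in>words n. weight n * alg_cost A (pad p))"
    unfolding a_def sum_divide_distrib
    by (intro sum.cong) (auto simp: weight_def potential_full)
  also have "3 / real m * (\<Sum>t<n. b t) \<le> (\<Sum>t<n. \<Sum>p\<in>words t. weight t * alg_cost A (pad p))"
    unfolding sum_distrib_left
  proof (intro sum_mono)
    fix t assume t: "t \<in> {..<n}"
    have "3 / real m * b t = (\<Sum>p\<in>words t. 3 / real m / real m ^ t * potential 0 n (partial_array A p))"
      by (simp add: b_def sum_distrib_left sum_divide_distrib)
    also have "\<dots> \<le> (\<Sum>p\<in>words t. 3 / real m / real m ^ t * (2 * alg_cost A (pad p)))"
      using t by (intro sum_mono mult_left_mono boundary_le_cost) auto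
    also have "\<dots> = (\<Sum>p\<in>words t. weight t * alg_cost A (pad p))"
      using t by (intro sum.cong) (auto simp: weight_def)
    finally show "3 / real m * b t \<le> (\<Sum>p\<in>words t. weight t * alg_cost A (pad p))" .
  qed
  finally show ?thesis
    by (simp add: lessThan_Suc_atMost[symmetric] add.commute)
qed

text \<open>Dividing \<open>n\<close> by this total bounds the largest cost from below;
  \<open>m\<close> about \<open>sqrt n\<close> balances the two summands.\<close>

lemma sum_weight: "(\<Sum>t\<le>n. \<Sum>p\<in>words t. weight t) = 4 * real m + 6 * real n / real m"
proof -
  have "(\<Sum>p\<in>words t. weight t) = (if t = n then 4 * real m else 6 / real m)" for t
    using m by (simp add: card_words weight_def)
  then show ?thesis
    by (simp add: lessThan_Suc_atMost[symmetric])
qed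

end

section \<open>From deterministic to randomized algorithms\<close>

lemma measurable_map_count_space:
  fixes f :: "'a \<Rightarrow> 'b \<Rightarrow> 'c::countable"
  assumes "\<And>x. x \<in> set l \<Longrightarrow> (\<lambda>w. f w x) \<in> M \<rightarrow>\<^sub>M count_space UNIV"
  shows "(\<lambda>w. map (f w) l) \<in> M \<rightarrow>\<^sub>M count_space UNIV"
proof -
  have "(\<lambda>w. map (f w) l) -` {ys} \<inter> space M \<in> sets M" for ys
  proof (cases "length ys = length l")
    case True
    then have "(\<lambda>w. map (f w) l) -` {ys} \<inter> space M
        = {w \<in> space M. \<forall>j\<in>{..<length l}. f w (l ! j) = ys ! j}"
      by (auto simp: list_eq_iff_nth_eq)
    also have "\<dots> \<in> sets M"
    proof (rule sets.sets_Collect_finite_All)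
      fix j assume "j \<in> {..<length l}"
      then have "(\<lambda>w. f w (l ! j)) -` {ys ! j} \<inter> space M \<in> sets M"
        using assms[of "l ! j"] by (intro measurable_sets[of _ M "count_space UNIV"]) auto
      moreover have "(\<lambda>w. f w (l ! j)) -` {ys ! j} \<inter> space M = {w \<in> space M. f w (l ! j) = ys ! j}"
        by auto
      ultimately show "{w \<in> space M. f w (l ! j) = ys ! j} \<in> sets M"
        by simp
    qed simp
    finally show ?thesis .
  next
    case False
    then have "(\<lambda>w. map (f w) l) -` {ys} \<inter> space M = {}"
      by auto
    then show ?thesis
      by simp
  qed
  then show ?thesis
    by (subst measurable_count_space_eq2_countable) auto
qed

lemma fill_cong:
  assumes "\<And>j. j < length xs \<Longrightarrow> p j = q j"
  shows "fill xs p = fill xs q"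
proof -
  have "the_inv_into {..<length xs} p = the_inv_into {..<length xs} q"
    using assms by (auto simp: the_inv_into_def fun_eq_iff intro!: arg_cong[where f = The])
  then show ?thesis
    by (simp add: fill_def)
qed

text \<open>The cost depends on the algorithm only through the list of its \<open>n\<close>
  placements, a random variable with countably many values.\<close>

lemma measurable_alg_cost:
  assumes "randomized_online_alg S n M" "xs \<in> inputs S n"
  shows "(\<lambda>A. alg_cost A xs) \<in> borel_measurable M"
proof -
  have len: "length xs = n"
    using assms(2) by (simp add: inputs_def)
  have "(\<lambda>A. placement A xs j) \<in> M \<rightarrow>\<^sub>M count_space UNIV" for j
  proof -
    have "length (take (Suc j) xs) \<le> n" "set (take (Suc j) xs) \<subseteq> S"
      using assms(2) by (auto simp: inputs_def dest: in_set_takeD)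
    then show ?thesis
      using assms(1) unfolding randomized_online_alg_def placement_def by blast
  qed
  then have "(\<lambda>A. map (placement A xs) [0..<n]) \<in> M \<rightarrow>\<^sub>M count_space UNIV"
    by (intro measurable_map_count_space)
  then have "(\<lambda>A. array_cost n (fill xs ((!) (map (placement A xs) [0..<n])))) \<in> borel_measurable M"
    by (rule measurable_compose) simp
  moreover have "fill xs ((!) (map (placement A xs) [0..<n])) = fill xs (placement A xs)" for A
    by (rule fill_cong) (simp add: len)
  ultimately show ?thesis
    by (simp add: alg_cost_def len)
qed

lemma ennreal_le_divide:
  fixes x c :: ennreal
  assumes "c \<le> 1"
  shows "x \<le> x / c"
proof -
  have "inverse 1 \<le> inverse c"
  proof (cases c)
    case (real r)
    then show ?thesis
      using assms by (cases "r = 0") (auto simp: inverse_ennreal one_le_inverse)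
  qed (use assms in \<open>simp add: top_unique\<close>)
  then have "x * 1 \<le> x * inverse c"
    by (intro mult_left_mono) auto
  then show ?thesis
    by (simp add: divide_ennreal_def)
qed

text \<open>\<open>weighted_cost_ge\<close> holds for all algorithms in \<open>space M\<close> with
  the same inputs and weights. Integrating it and bounding each expected cost by the ratio, as the
  optimum is at most 1, yields
  \<open>n \<le> (4 * m + 6 * n / m) * rand_ratio S n M\<close>.\<close>

lemma rand_ratio_ge:
  assumes S: "{0..1} \<subseteq> S" and n: "2 \<le> n" and M: "randomized_online_alg S n M"
  shows "ennreal (sqrt (real n) / 14) \<le> rand_ratio S n M"
proof -
  define m where "m = nat \<lceil>sqrt (real n)\<rceil>"
  have sqrt1: "1 \<le> sqrt (real n)"
    using n by simp
  have m_ge: "sqrt (real n) \<le> real m" and m_le: "real m \<le> 2 * sqrt (real n)"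
    unfolding m_def using sqrt1 by linarith+
  have m: "0 < m"
    using sqrt1 m_ge by (cases m) auto
  interpret prob_space M
    using M by (simp add: randomized_online_alg_def)
  have adv: "oblivious_adversary S n A m" if "A \<in> space M" for A
    using that M S n m by unfold_locales (auto simp: randomized_online_alg_def)
  \<comment> \<open>\<open>A0\<close> gives access to the constants of the locale;
    \<open>words\<close>, \<open>pad\<close> and \<open>weight\<close> depend on \<open>n\<close>
    and \<open>m\<close> alone, which is why one set of inputs serves all algorithms.\<close>
  obtain A0 where "A0 \<in> space M"
    using not_empty by blast
  then interpret A0: oblivious_adversary S n A0 m
    by (rule adv)
  let ?L = "rand_ratio S n M"
  let ?c = "\<lambda>xs. \<integral>\<^sup>+A. ennreal (alg_cost A xs) \<partial>M"
  have w: "0 \<le> A0.weight t" for t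
    by (simp add: A0.weight_def)
  have cost_le: "?c (A0.pad p) \<le> ?L" if "t \<le> n" "p \<in> A0.words t" for t p
  proof -
    have pad: "A0.pad p \<in> inputs {0..1} n" "A0.pad p \<in> inputs S n"
      using A0.pad_inputs[of p] that by auto
    have "?c (A0.pad p) \<le> ?c (A0.pad p) / ennreal (OPT (A0.pad p))"
      using OPT_le_1[OF pad(1)] by (intro ennreal_le_divide) simp
    also have "\<dots> \<le> ?L"
      unfolding rand_ratio_def by (rule SUP_upper[OF pad(2)])
    finally show ?thesis .
  qed
  have "ennreal (real n) = (\<integral>\<^sup>+A. ennreal (real n) \<partial>M)"
    by (simp add: emeasure_space_1)
  also have "\<dots> \<le> (\<integral>\<^sup>+A. (\<Sum>t\<le>n. \<Sum>p\<in>A0.words t.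
      ennreal (A0.weight t) * ennreal (alg_cost A (A0.pad p))) \<partial>M)"
  proof (rule nn_integral_mono)
    fix A assume "A \<in> space M"
    then interpret A: oblivious_adversary S n A m
      by (rule adv)
    have "ennreal (real n) \<le> ennreal (\<Sum>t\<le>n. \<Sum>p\<in>A0.words t. A0.weight t * alg_cost A (A0.pad p))"
      using A.weighted_cost_ge by (rule ennreal_leI)
    also have "\<dots> = (\<Sum>t\<le>n. \<Sum>p\<in>A0.words t. ennreal (A0.weight t) * ennreal (alg_cost A (A0.pad p)))"
      using w alg_cost_nonneg by (simp add: sum_nonneg ennreal_mult flip: sum_ennreal)
    finally show "ennreal (real n) \<le> \<dots>" .
  qed
  also have "\<dots> = (\<Sum>t\<le>n. \<Sum>p\<in>A0.words t. ennreal (A0.weight t) * ?c (A0.pad p))"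
  proof -
    have meas: "(\<lambda>A. ennreal (alg_cost A (A0.pad p))) \<in> borel_measurable M"
      if "t \<le> n" "p \<in> A0.words t" for t p
      using measurable_alg_cost[OF M A0.pad_inputs(2)[of p]] that by auto
    have meas_w: "(\<lambda>A. ennreal (A0.weight t) * ennreal (alg_cost A (A0.pad p))) \<in> borel_measurable M"
      if "t \<le> n" "p \<in> A0.words t" for t p
      using meas[OF that] by (intro borel_measurable_times_ennreal) auto
    have "(\<integral>\<^sup>+A. (\<Sum>t\<le>n. \<Sum>p\<in>A0.words t.
        ennreal (A0.weight t) * ennreal (alg_cost A (A0.pad p))) \<partial>M)
      = (\<Sum>t\<le>n. \<integral>\<^sup>+A. (\<Sum>p\<in>A0.words t.
        ennreal (A0.weight t) * ennreal (alg_cost A (A0.pad p))) \<partial>M)"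
      by (rule nn_integral_sum) (intro borel_measurable_sum meas_w; simp)
    also have "\<dots> = (\<Sum>t\<le>n. \<Sum>p\<in>A0.words t.
        \<integral>\<^sup>+A. ennreal (A0.weight t) * ennreal (alg_cost A (A0.pad p)) \<partial>M)"
      by (intro sum.cong refl nn_integral_sum meas_w) auto
    also have "\<dots> = (\<Sum>t\<le>n. \<Sum>p\<in>A0.words t. ennreal (A0.weight t) * ?c (A0.pad p))"
      by (intro sum.cong refl nn_integral_cmult meas) auto
    finally show ?thesis .
  qed
  also have "\<dots> \<le> (\<Sum>t\<le>n. \<Sum>p\<in>A0.words t. ennreal (A0.weight t) * ?L)"
    using cost_le by (intro sum_mono mult_left_mono) auto
  also have "\<dots> = ennreal (\<Sum>t\<le>n. \<Sum>p\<in>A0.words t. A0.weight t) * ?L"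
    using w by (simp add: sum_nonneg sum_distrib_right flip: sum_ennreal del: sum_constant)
  also have "(\<Sum>t\<le>n. \<Sum>p\<in>A0.words t. A0.weight t) = 4 * real m + 6 * real n / real m"
    by (rule A0.sum_weight)
  also have "ennreal (4 * real m + 6 * real n / real m) * ?L \<le> ennreal (14 * sqrt (real n)) * ?L"
  \<comment> \<open>Since \<open>m\<close> lies between \<open>sqrt n\<close> and
    \<open>2 * sqrt n\<close>, the two summands are at most \<open>8 * sqrt n\<close> and
    \<open>6 * sqrt n\<close>.\<close>
  proof (intro mult_right_mono ennreal_leI)
    have "real n / real m \<le> real n / sqrt (real n)"
      using m_ge m n by (intro divide_left_mono mult_pos_pos) auto
    then have "real n / real m \<le> sqrt (real n)"
      by (simp add: real_div_sqrt)
    then show "4 * real m + 6 * real n / real m \<le> 14 * sqrt (real n)"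
      using m_le by simp
  qed simp
  finally have main: "ennreal (real n) \<le> ennreal (14 * sqrt (real n)) * ?L" .
  show ?thesis
  proof (cases "?L = top")
    case False
    then obtain l where l: "?L = ennreal l" "0 \<le> l"
      by (cases ?L) auto
    have "ennreal (real n) \<le> ennreal (14 * sqrt (real n) * l)"
      using main l by (simp add: ennreal_mult)
    then have "real n \<le> 14 * sqrt (real n) * l"
      using l by (simp add: ennreal_le_iff)
    then have "sqrt (real n) * sqrt (real n) \<le> sqrt (real n) * (14 * l)"
      by (simp add: mult_ac)
    then have "sqrt (real n) \<le> 14 * l"
      using sqrt1 by (simp only: mult_le_cancel_left_pos)
    then show ?thesis
      using l by (simp add: ennreal_leI)
  qed simp
qed

section \<open>The competitive ratio\<close>

text \<open>\<open>count_space {A}\<close> is the point mass at \<open>A\<close>. Hence lower bounds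
  for randomized algorithms cover deterministic ones, and deterministic upper bounds carry over to
  randomized algorithms.\<close>

lemma randomized_count_space_singleton:
  assumes "online_alg S n A"
  shows "randomized_online_alg S n (count_space {A})"
    and "rand_ratio S n (count_space {A}) = det_ratio S n A"
proof -
  have "prob_space (count_space {A})"
    by (rule prob_spaceI) simp
  then show "randomized_online_alg S n (count_space {A})"
    using assms by (simp add: randomized_online_alg_def)
  show "rand_ratio S n (count_space {A}) = det_ratio S n A"
    by (simp add: rand_ratio_def det_ratio_def nn_integral_count_space_finite)
qed

lemma det_ratio_ge:
  assumes "{0..1} \<subseteq> S" "2 \<le> n" "online_alg S n A"
  shows "ennreal (sqrt (real n) / 14) \<le> det_ratio S n A"
  using rand_ratio_ge[OF assms(1,2)] randomized_count_space_singleton[OF assms(3)] by metis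

text \<open>The spread of the items is at most the optimum, so \<open>OPT xs\<close> may serve as
  \<open>D\<close>.\<close>

lemma det_ratio_le:
  "\<exists>A. online_alg UNIV n A \<and> det_ratio UNIV n A \<le> ennreal (500 * sqrt (real n))"
proof -
  obtain A where A: "online_alg UNIV n A" and cost: "\<And>xs D. xs \<in> inputs UNIV n \<Longrightarrow> 0 \<le> D \<Longrightarrow>
     (\<forall>u\<in>set xs. \<forall>v\<in>set xs. \<bar>u - v\<bar> \<le> D) \<Longrightarrow> alg_cost A xs \<le> 500 * sqrt (real n) * D"
    using sqrt_competitive_alg[of n] by blast
  have "ennreal (alg_cost A xs) / ennreal (OPT xs) \<le> ennreal (500 * sqrt (real n))"
    if xs: "xs \<in> inputs UNIV n" for xs
  proof -
    have nonneg: "0 \<le> OPT xs"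
    proof -
      have "{p. p permutes {..<length xs}} \<noteq> {}"
        using permutes_id by blast
      then show ?thesis
        unfolding OPT_def by (subst Min_ge_iff) (auto simp: finite_permutations array_cost_nonneg)
    qed
    have le: "alg_cost A xs \<le> 500 * sqrt (real n) * OPT xs"
      by (rule cost[OF xs nonneg]) (use abs_diff_le_OPT in blast)
    show ?thesis
    proof (cases "OPT xs = 0")
      case True
      then show ?thesis
        using le alg_cost_nonneg[of A xs] by simp
    next
      case False
      then show ?thesis
        using nonneg le alg_cost_nonneg[of A xs]
        by (simp add: divide_ennreal ennreal_leI pos_divide_le_eq)
    qed
  qed
  then have "det_ratio UNIV n A \<le> ennreal (500 * sqrt (real n))"
    unfolding det_ratio_def by (rule SUP_least)
  with A show ?thesis
    by blast
qed

lemma enn2real_between_bigtheta: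
  assumes "\<And>n. 2 \<le> n \<Longrightarrow> ennreal (sqrt (real n) / 14) \<le> f n"
    and "\<And>n. f n \<le> ennreal (500 * sqrt (real n))"
  shows "(\<lambda>n. enn2real (f n)) \<in> \<Theta>(\<lambda>n. sqrt (real n))"
proof (rule bigthetaI)
  \<comment> \<open>\<open>enn2real\<close> sends \<open>top\<close> to 0, so the lower bound
    carries over only once \<open>f n\<close> is known to be finite.\<close>
  have "f n < top" for n
    using assms(2)[of n] by (simp add: le_less_trans ennreal_less_top)
  then have lower: "sqrt (real n) / 14 \<le> enn2real (f n)" if "2 \<le> n" for n
    using enn2real_mono[OF assms(1)[OF that]] by simp
  have upper: "enn2real (f n) \<le> 500 * sqrt (real n)" for n
    using enn2real_mono[OF assms(2)[of n]] by simp
  show "(\<lambda>n. enn2real (f n)) \<in> O(\<lambda>n. sqrt (real n))"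
    by (rule bigoI[where c = 500]) (use upper in simp)
  have "eventually (\<lambda>n. 1 / 14 * norm (sqrt (real n)) \<le> norm (enn2real (f n))) at_top"
    using eventually_ge_at_top[of 2] by eventually_elim (use lower in simp)
  then show "(\<lambda>n. enn2real (f n)) \<in> \<Omega>(\<lambda>n. sqrt (real n))"
    by (rule landau_omega.bigI[rotated]) simp
qed

theorem theorem1:
  shows "(\<lambda>n. enn2real (best_det_ratio UNIV n)) \<in> \<Theta>(\<lambda>n. sqrt (real n)) \<and>
    (\<lambda>n. enn2real (best_rand_ratio UNIV n)) \<in> \<Theta>(\<lambda>n. sqrt (real n)) \<and>
    (\<exists>A. (\<forall>n. online_alg UNIV n (A n)) \<and>
         (\<exists>C>0. \<forall>\<^sub>F n in sequentially. det_ratio UNIV n (A n) \<le> ennreal (C * sqrt (real n)))) \<and>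
    (\<forall>S\<in>{UNIV, {0..1}}. \<exists>c>0. \<forall>\<^sub>F n in sequentially.
         (\<forall>A. online_alg S n A \<longrightarrow> ennreal (c * sqrt (real n)) \<le> det_ratio S n A) \<and>
         (\<forall>M. randomized_online_alg S n M \<longrightarrow> ennreal (c * sqrt (real n)) \<le> rand_ratio S n M))"
proof (intro conjI ballI)
  obtain A where A: "\<And>n. online_alg UNIV n (A n)"
    "\<And>n. det_ratio UNIV n (A n) \<le> ennreal (500 * sqrt (real n))"
    using det_ratio_le by metis
  show "(\<lambda>n. enn2real (best_det_ratio UNIV n)) \<in> \<Theta>(\<lambda>n. sqrt (real n))"
  proof (rule enn2real_between_bigtheta)
    show "ennreal (sqrt (real n) / 14) \<le> best_det_ratio UNIV n" if "2 \<le> n" for n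
      unfolding best_det_ratio_def using det_ratio_ge that by (intro INF_greatest) auto
    show "best_det_ratio UNIV n \<le> ennreal (500 * sqrt (real n))" for n
      unfolding best_det_ratio_def using A by (intro INF_lower2[of "A n"]) auto
  qed
  show "(\<lambda>n. enn2real (best_rand_ratio UNIV n)) \<in> \<Theta>(\<lambda>n. sqrt (real n))"
  proof (rule enn2real_between_bigtheta)
    show "ennreal (sqrt (real n) / 14) \<le> best_rand_ratio UNIV n" if "2 \<le> n" for n
      unfolding best_rand_ratio_def using rand_ratio_ge that by (intro INF_greatest) auto
    show "best_rand_ratio UNIV n \<le> ennreal (500 * sqrt (real n))" for n
      unfolding best_rand_ratio_def
      using A randomized_count_space_singleton[OF A(1)]
      by (intro INF_lower2[of "count_space {A n}"]) auto
  qed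
  show "\<exists>A. (\<forall>n. online_alg UNIV n (A n)) \<and>
      (\<exists>C>0. \<forall>\<^sub>F n in sequentially. det_ratio UNIV n (A n) \<le> ennreal (C * sqrt (real n)))"
    using A by (intro exI[of _ A] conjI exI[of _ 500]) auto
  fix S :: "real set" assume "S \<in> {UNIV, {0..1}}"
  then have S: "{0..1} \<subseteq> S"
    by auto
  have "\<forall>\<^sub>F n in sequentially.
      (\<forall>A. online_alg S n A \<longrightarrow> ennreal (1 / 14 * sqrt (real n)) \<le> det_ratio S n A) \<and>
      (\<forall>M. randomized_online_alg S n M \<longrightarrow> ennreal (1 / 14 * sqrt (real n)) \<le> rand_ratio S n M)"
    \<comment> \<open>A single cell costs nothing, so the lower bound fails for
      \<open>n = 1\<close>.\<close>
    using eventually_ge_at_top[of 2]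
    by eventually_elim (use det_ratio_ge[OF S] rand_ratio_ge[OF S] in simp)
  then show "\<exists>c>0. \<forall>\<^sub>F n in sequentially.
      (\<forall>A. online_alg S n A \<longrightarrow> ennreal (c * sqrt (real n)) \<le> det_ratio S n A) \<and>
      (\<forall>M. randomized_online_alg S n M \<longrightarrow> ennreal (c * sqrt (real n)) \<le> rand_ratio S n M)"
    by (intro exI[of _ "1 / 14"] conjI) auto
qed

end
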